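(* Let $d\ge 2$ and $r\in\mathbb N$. There is a constant $C(r,d)>0$, depending only on $r$ and $d$, such that for every $m\in\mathbb N$ and every cubature formula $(\xi,\Lambda)$ with $m$ knots $\xi=(\xi^1,\dots,\xi^m)$, $\xi^\mu\in[0,1)^d$, and weights $\Lambda=(\lambda_1,\dots,\lambda_m)$, $$\tilde D^{r,c}_{2,2}(\xi,\Lambda)\ \ge\ C(r,d)\, m^{-r}(\log m)^{(d-1)/2}.$$
   Context: A cubature formula $(\xi,\Lambda)$ with $m$ knots consists of points $\xi^1,\dots,\xi^m\in[0,1)^d$ and real weights $\lambda_1,\dots,\lambda_m$ (no positivity or normalization is assumed). Hat functions for cubes. For $u>0$, $x\in\mathbb R$, let $h^1(x,u):=\chi_{[-u/2,u/2)}(x)$ (characteristic function) and, for $r\ge2$, $h^r(\cdot,u):=h^{r-1}(\cdot,u)\ast h^1(\cdot,u)$, where $(f\ast g)(x)=\int_{\mathbb R}f(x-y)g(y)\,dy$. For $\mathbf x\in\mathbb R^d$, $\mathbf z\in[0,1)^d$ and a scalar $u\in(0,1/2]$ let $$\tilde h^r(\mathbf x,\mathbf z,u):=\sum_{\mathbf n\in\mathbb Z^d}\ \prod_{j=1}^d h^r(n_j+x_j-z_j,u),$$ the $1$-periodization in $\mathbf x$ of the product hat function with the same parameter $u$ in all coordinates. Periodic $r$-smooth $L_{\mathbf p}$-discrepancy for cubes. For $1\le p_1,p_2\le\infty$, $$\tilde D^{r,c}_{p_1,p_2}(\xi,\Lambda):=\left\|\,\Big\|\int_{[0,1)^d}\tilde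 h^r(\mathbf x,\mathbf z,u)\,d\mathbf x-\sum_{\mu=1}^m\lambda_\mu\tilde h^r(\xi^\mu,\mathbf z,u)\Big\|_{p_1}\right\|_{p_2},$$ where the inner $L_{p_1}$ norm is in $\mathbf z$ over $[0,1)^d$ and the outer $L_{p_2}$ norm is in $u$ over the interval $(0,1/2]$, both with respect to Lebesgue measure. *)

theory Defs
  imports "HOL-Analysis.Analysis" "HOL-Probability.Essential_Supremum"
begin

definition half_open_cube :: "(real ^ 'd::finite) set" where
  "half_open_cube = {x. \<forall>j. 0 \<le> x $ j \<and> x $ j < 1}"

text \<open>The norm of \<open>L\<^sub>p(M)\<close> for \<open>1 \<le> p \<le> \<infinity>\<close>. It is real-valued, hence meaningful only for
  \<open>f\<close> in \<open>L\<^sub>p(M)\<close>; below it is applied only to bounded Borel functions on finite measure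
  spaces.\<close>

definition Lp_norm :: "ennreal \<Rightarrow> 'a measure \<Rightarrow> ('a \<Rightarrow> real) \<Rightarrow> real" where
  "Lp_norm p M f =
    (if p = \<infinity> then real_of_ereal (esssup M (\<lambda>x. ereal \<bar>f x\<bar>))
     else (LINT x|M. \<bar>f x\<bar> powr enn2real p) powr (1 / enn2real p))"

lemma Lp_norm_2: "Lp_norm 2 M f = sqrt (LINT x|M. (f x)\<^sup>2)"
  by (simp add: Lp_norm_def powr_half_sqrt)

definition real_convolution :: "(real \<Rightarrow> real) \<Rightarrow> (real \<Rightarrow> real) \<Rightarrow> real \<Rightarrow> real" where
  "real_convolution f g x = (LINT y|lborel. f (x - y) * g y)"

text \<open>\<open>hat r x u\<close> is \<open>h\<^sup>r(x,u)\<close>, which is defined for \<open>r \<ge> 1\<close> only; the value at \<open>r = 0\<close> is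
  a dummy.\<close>

fun hat :: "nat \<Rightarrow> real \<Rightarrow> real \<Rightarrow> real" where
  "hat 0 x u = 0"
| "hat (Suc 0) x u = indicator {- u / 2 ..< u / 2} x"
| "hat (Suc (Suc r)) x u =
    real_convolution (\<lambda>t. hat (Suc r) t u) (\<lambda>t. hat (Suc 0) t u) x"

text \<open>Since \<open>hat r\<close> vanishes outside \<open>[-ru/2, ru/2)\<close> in its first argument, only finitely many
  terms of the following sum over the integer lattice are nonzero.\<close>

definition periodic_hat :: "nat \<Rightarrow> real ^ 'd::finite \<Rightarrow> real ^ 'd \<Rightarrow> real \<Rightarrow> real" where
  "periodic_hat r x z u =
    (\<Sum>\<^sub>\<infinity>n\<in>(UNIV :: (int ^ 'd) set). \<Prod>j\<in>UNIV. hat r (of_int (n $ j) + x $ j - z $ j) u)"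

definition cubature_error ::
  "nat \<Rightarrow> nat \<Rightarrow> (nat \<Rightarrow> real ^ 'd::finite) \<Rightarrow> (nat \<Rightarrow> real) \<Rightarrow> real ^ 'd \<Rightarrow> real \<Rightarrow> real" where
  "cubature_error r m \<xi> \<Lambda> z u =
    (LINT x:half_open_cube|lborel. periodic_hat r x z u)
      - (\<Sum>\<mu>=1..m. \<Lambda> \<mu> * periodic_hat r (\<xi> \<mu>) z u)"

definition cube_discrepancy ::
  "nat \<Rightarrow> ennreal \<Rightarrow> ennreal \<Rightarrow> nat \<Rightarrow> (nat \<Rightarrow> real ^ 'd::finite) \<Rightarrow> (nat \<Rightarrow> real) \<Rightarrow> real" where
  "cube_discrepancy r p\<^sub>1 p\<^sub>2 m \<xi> \<Lambda> =
    Lp_norm p\<^sub>2 (restrict_space lborel {0<..1/2})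
      (\<lambda>u. Lp_norm p\<^sub>1 (restrict_space lborel half_open_cube) (\<lambda>z. cubature_error r m \<xi> \<Lambda> z u))"

end

theory Submission
  imports Defs
begin

text \<open>
  For fixed \<open>u\<close> the Fourier coefficients of the cubature error in \<open>z\<close> factor as
  \<open>\<Prod>\<^sub>j (sin (\<pi> k\<^sub>j u) / (\<pi> k\<^sub>j))\<^sup>r\<close> (with factor \<open>u\<^sup>r\<close> if \<open>k\<^sub>j = 0\<close>) times the error \<open>a\<^sub>k\<close> of the formula on an exponential. By Bessel's
  inequality and averaging over \<open>u\<close>, which removes the zeros of the sines, the squared discrepancy
  is at least a constant times the sum of \<open>|a\<^sub>k|\<^sup>2 \<Prod>\<^sub>j max(1, |k\<^sub>j|)\<close> to the power \<open>-2r\<close>. This sum is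
  bounded below by duality with a trigonometric polynomial that vanishes at all knots. For
  \<open>2m \<le> 2\<^sup>n \<le> 4m\<close> and every dyadic box of frequencies of side lengths \<open>2\<close> to the power \<open>s\<^sub>j\<close> with
  \<open>\<Sum>\<^sub>j s\<^sub>j = n\<close>, there is such a polynomial with values in \<open>[0, 1]\<close> and mean at least 1/2. Their sum
  has mean at least of order \<open>n\<close> to the power \<open>d - 1\<close>, while its terms are almost orthogonal in the
  dual weighted norm, because \<open>\<Sum>\<^sub>j min s\<^sub>j t\<^sub>j = n - |s - t|\<^sub>1 / 2\<close>.
\<close>

text \<open>A single box would only give the order \<open>m\<close> to the power \<open>-r\<close>.
  The logarithm comes from a quadratic against a linear count: if \<open>N\<close> boxes are summed,
  the squared mean of the sum is at least of order \<open>N^2\<close>, its squared weighted norm at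
  most of order \<open>4^(r*n) * N\<close>, and Cauchy-Schwarz leaves \<open>N / 4^(r*n)\<close> for
  the squared discrepancy, with \<open>N\<close> at least of order \<open>n^(d-1)\<close> and
  \<open>2^n\<close> of order \<open>m\<close>. The square root halves the exponent. Weights of any
  sign and size are harmless, because a test polynomial that vanishes at every knot removes the
  cubature sum altogether. A box of volume \<open>2^n >= 2*m\<close> lets the \<open>m\<close> knot
  vectors span at most half of the dimension, hence the mean 1/2. The values in [0, 1] bound the sum
  of the squared coefficients by 1, which is where the weighted estimate starts. No single
  \<open>u\<close> would do for this route: at \<open>u = 1/2\<close>, for instance, every frequency
  vector with a nonzero even component is invisible.\<close>

section \<open>Bessel inequality and Gram--Schmidt\<close>

text \<open>The squared norm of \<open>f\<close> minus its projection is nonnegative. The measure is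
  arbitrary because the inequality serves both the counting measure on a frequency set and Lebesgue
  measure on the cube.\<close>

lemma bessel_inequality:
  fixes f :: "'a \<Rightarrow> complex" and e :: "'i \<Rightarrow> 'a \<Rightarrow> complex"
  assumes fin: "finite K"
    and ff: "integrable M (\<lambda>x. (cmod (f x))\<^sup>2)"
    and fe: "\<And>k. k \<in> K \<Longrightarrow> integrable M (\<lambda>x. f x * cnj (e k x))"
    and ee: "\<And>k l. k \<in> K \<Longrightarrow> l \<in> K \<Longrightarrow> integrable M (\<lambda>x. e k x * cnj (e l x))"
    and orth: "\<And>k l. k \<in> K \<Longrightarrow> l \<in> K \<Longrightarrow>
      (\<integral>x. e k x * cnj (e l x) \<partial>M) = (if k = l then 1 else 0)"
  shows "(\<Sum>k\<in>K. (cmod (\<integral>x. f x * cnj (e k x) \<partial>M))\<^sup>2) \<le> (\<integral>x. (cmod (f x))\<^sup>2 \<partial>M)"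
proof -
  define a where "a k = (\<integral>x. f x * cnj (e k x) \<partial>M)" for k
  define g where "g x = f x - (\<Sum>k\<in>K. a k * e k x)" for x
  have g_sq: "complex_of_real ((cmod (g x))\<^sup>2) = complex_of_real ((cmod (f x))\<^sup>2)
      - (\<Sum>k\<in>K. cnj (a k) * (f x * cnj (e k x)))
      - (\<Sum>k\<in>K. a k * cnj (f x * cnj (e k x)))
      + (\<Sum>k\<in>K. \<Sum>l\<in>K. a k * cnj (a l) * (e k x * cnj (e l x)))" for x
    unfolding complex_norm_square g_def
    by (simp add: algebra_simps sum_distrib_left sum_distrib_right sum_product) (rule sum.swap)
  have "has_bochner_integral M (\<lambda>x. complex_of_real ((cmod (g x))\<^sup>2))
      (complex_of_real (\<integral>x. (cmod (f x))\<^sup>2 \<partial>M)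
      - (\<Sum>k\<in>K. cnj (a k) * a k) - (\<Sum>k\<in>K. a k * cnj (a k))
      + (\<Sum>k\<in>K. \<Sum>l\<in>K. a k * cnj (a l) * (if k = l then 1 else 0)))"
    unfolding g_sq
  proof (intro has_bochner_integral_add has_bochner_integral_diff has_bochner_integral_sum
      has_bochner_integral_mult_right)
    show "has_bochner_integral M (\<lambda>x. complex_of_real ((cmod (f x))\<^sup>2))
        (complex_of_real (\<integral>x. (cmod (f x))\<^sup>2 \<partial>M))"
      using ff by (intro has_bochner_integral_of_real has_bochner_integral_integrable)
    show fe': "has_bochner_integral M (\<lambda>x. f x * cnj (e k x)) (a k)" if "k \<in> K" for k
      unfolding a_def using fe[OF that] by (rule has_bochner_integral_integrable)
    show "has_bochner_integral M (\<lambda>x. cnj (f x * cnj (e k x))) (cnj (a k))" if "k \<in> K" for k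
      using fe'[OF that] by (rule has_bochner_integral_cnj)
    show "has_bochner_integral M (\<lambda>x. e k x * cnj (e l x)) (if k = l then 1 else 0)"
      if "k \<in> K" "l \<in> K" for k l
      using that ee orth by (simp add: has_bochner_integral_iff)
  qed
  moreover have "(\<Sum>k\<in>K. \<Sum>l\<in>K. a k * cnj (a l) * (if k = l then 1 else 0)) = (\<Sum>k\<in>K. a k * cnj (a k))"
  proof (rule sum.cong[OF refl])
    fix k assume "k \<in> K"
    have "(\<Sum>l\<in>K. a k * cnj (a l) * (if k = l then 1 else 0)) = (\<Sum>l\<in>K. if k = l then a k * cnj (a l) else 0)"
      by (intro sum.cong) auto
    thus "(\<Sum>l\<in>K. a k * cnj (a l) * (if k = l then 1 else 0)) = a k * cnj (a k)"
      using fin \<open>k \<in> K\<close> by simp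
  qed
  ultimately have "(\<integral>x. complex_of_real ((cmod (g x))\<^sup>2) \<partial>M)
      = complex_of_real (\<integral>x. (cmod (f x))\<^sup>2 \<partial>M) - (\<Sum>k\<in>K. cnj (a k) * a k)"
    by (simp add: has_bochner_integral_iff del: of_real_power)
  also have "\<dots> = complex_of_real ((\<integral>x. (cmod (f x))\<^sup>2 \<partial>M) - (\<Sum>k\<in>K. (cmod (a k))\<^sup>2))"
    unfolding of_real_diff of_real_sum complex_norm_square by (simp add: mult.commute)
  finally have "(\<integral>x. (cmod (g x))\<^sup>2 \<partial>M) = (\<integral>x. (cmod (f x))\<^sup>2 \<partial>M) - (\<Sum>k\<in>K. (cmod (a k))\<^sup>2)"
    by (metis integral_complex_of_real of_real_eq_iff)
  moreover have "0 \<le> (\<integral>x. (cmod (g x))\<^sup>2 \<partial>M)" by simp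
  ultimately show ?thesis by (simp add: a_def)
qed

text \<open>Induction on the number of vectors: the new vector minus its projection is either zero,
  and the system is kept, or it is normalized and appended. The vectors \<open>w\<close> may be
  dependent; \<open>q <= m\<close> is the dimension bound needed later.\<close>

lemma gram_schmidt:
  fixes w :: "nat \<Rightarrow> 'k \<Rightarrow> complex"
  assumes "finite K"
  shows "\<exists>q v. q \<le> m
    \<and> (\<forall>i<q. \<forall>j<q. (\<Sum>k\<in>K. v i k * cnj (v j k)) = (if i = j then 1 else 0))
    \<and> (\<forall>\<mu><m. \<forall>k\<in>K. w \<mu> k = (\<Sum>i<q. (\<Sum>l\<in>K. w \<mu> l * cnj (v i l)) * v i k))"
proof -
  define ip where "ip a b = (\<Sum>k\<in>K. a k * cnj (b k))" for a b :: "'k \<Rightarrow> complex"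
  have "\<exists>q v. q \<le> m
    \<and> (\<forall>i<q. \<forall>j<q. ip (v i) (v j) = (if i = j then 1 else 0))
    \<and> (\<forall>\<mu><m. \<forall>k\<in>K. w \<mu> k = (\<Sum>i<q. ip (w \<mu>) (v i) * v i k))"
  proof (induction m)
    case 0
    show ?case by (intro exI[of _ 0]) auto
  next
    case (Suc m)
    from Suc obtain q v where q: "q \<le> m"
      and orth: "\<And>i j. i < q \<Longrightarrow> j < q \<Longrightarrow> ip (v i) (v j) = (if i = j then 1 else 0)"
      and span: "\<And>\<mu> k. \<mu> < m \<Longrightarrow> k \<in> K \<Longrightarrow> w \<mu> k = (\<Sum>i<q. ip (w \<mu>) (v i) * v i k)"
      by blast
    have ip_cnj: "ip a b = cnj (ip b a)" for a b
      by (simp add: ip_def mult.commute)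
    have ip_sum: "ip (\<lambda>k. \<Sum>i<q. c i * v i k) b = (\<Sum>i<q. c i * ip (v i) b)" for c b
      unfolding ip_def by (subst sum_distrib_left, subst sum.swap) (simp add: sum_distrib_right mult.assoc)
    have ip_cong: "ip a b = ip a' b" if "\<And>k. k \<in> K \<Longrightarrow> a k = a' k" for a a' b
      unfolding ip_def using that by (intro sum.cong) auto
    define \<rho> where "\<rho> k = w m k - (\<Sum>i<q. ip (w m) (v i) * v i k)" for k
    have ip_\<rho>: "ip \<rho> b = ip (w m) b - (\<Sum>i<q. ip (w m) (v i) * ip (v i) b)" for b
      unfolding ip_sum[symmetric] by (simp add: ip_def \<rho>_def algebra_simps sum_subtractf)
    have \<rho>_v: "ip \<rho> (v j) = 0" if "j < q" for j
    proof -
      have "(\<Sum>i<q. ip (w m) (v i) * ip (v i) (v j)) = (\<Sum>i<q. if i = j then ip (w m) (v i) else 0)"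
        using that orth by (intro sum.cong) auto
      thus ?thesis using that by (simp add: ip_\<rho>)
    qed
    hence v_\<rho>: "ip (v j) \<rho> = 0" if "j < q" for j
      using that ip_cnj[of "v j" \<rho>] by simp
    show ?case
    proof (cases "\<forall>k\<in>K. \<rho> k = 0")
      case True
      have "w \<mu> k = (\<Sum>i<q. ip (w \<mu>) (v i) * v i k)" if "\<mu> < Suc m" "k \<in> K" for \<mu> k
        using that span True by (cases "\<mu> = m") (auto simp: \<rho>_def)
      thus ?thesis using q orth by (meson le_SucI)
    next
      case False
      define N where "N = (\<Sum>k\<in>K. (cmod (\<rho> k))\<^sup>2)"
      have "N > 0"
        unfolding N_def using False assms by (auto intro!: sum_pos2)
      have ip_N: "ip \<rho> \<rho> = complex_of_real N"
        unfolding ip_def N_def of_real_sum complex_norm_square ..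
      define s where "s = complex_of_real (sqrt N)"
      have s: "s \<noteq> 0" "cnj s = s" "s * s = complex_of_real N"
        using \<open>N > 0\<close> by (auto simp: s_def simp flip: of_real_mult)
      define v' where "v' = v(q := \<lambda>k. \<rho> k / s)"
      have ip_v'q: "ip (v' q) b = ip \<rho> b / s" "ip b (v' q) = ip b \<rho> / s" for b
        using s by (auto simp: ip_def v'_def sum_divide_distrib)
      have v'_less: "v' i = v i" if "i < q" for i
        using that by (simp add: v'_def)
      have orth': "ip (v' i) (v' j) = (if i = j then 1 else 0)" if "i < Suc q" "j < Suc q" for i j
      proof (cases "i = q"; cases "j = q")
        assume "i = q" "j = q"
        have "ip (v' q) (v' q) = ip \<rho> \<rho> / s / s" by (simp only: ip_v'q)
        thus ?thesis using s(1) \<open>i = q\<close> \<open>j = q\<close> by (simp add: ip_N flip: s(3))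
      qed (use that in \<open>auto simp: ip_v'q v'_less orth \<rho>_v v_\<rho>\<close>)
      \<comment> \<open>The residual is orthogonal to the old system. Hence pairing it with
        \<open>w m\<close> gives its own squared norm, and pairing it with earlier vectors, which
        lie in the old span, gives 0.\<close>
      have w_\<rho>: "ip (w \<mu>) \<rho> = (if \<mu> = m then complex_of_real N else 0)" if "\<mu> < Suc m" for \<mu>
      proof (cases "\<mu> = m")
        case True
        have "ip \<rho> \<rho> = ip (w m) \<rho>"
          by (subst ip_\<rho>) (simp add: v_\<rho>)
        thus ?thesis using True ip_N by simp
      next
        case False
        hence "ip (w \<mu>) \<rho> = ip (\<lambda>k. \<Sum>i<q. ip (w \<mu>) (v i) * v i k) \<rho>"
          using that by (intro ip_cong span) auto
        also have "\<dots> = 0" by (simp add: ip_sum v_\<rho>)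
        finally show ?thesis using False by simp
      qed
      have span': "w \<mu> k = (\<Sum>i<Suc q. ip (w \<mu>) (v' i) * v' i k)" if "\<mu> < Suc m" "k \<in> K" for \<mu> k
      proof -
        have "(\<Sum>i<Suc q. ip (w \<mu>) (v' i) * v' i k)
            = (\<Sum>i<q. ip (w \<mu>) (v i) * v i k) + ip (w \<mu>) \<rho> / s * (\<rho> k / s)"
          by (simp add: ip_v'q v'_less) (simp add: v'_def)
        also have "ip (w \<mu>) \<rho> / s * (\<rho> k / s) = (if \<mu> = m then \<rho> k else 0)"
          using s \<open>N > 0\<close> by (simp add: w_\<rho>[OF that(1)])
        finally show ?thesis
          using that span[of \<mu> k] by (cases "\<mu> = m") (simp_all add: \<rho>_def)
      qed
      moreover have "Suc q \<le> Suc m" using q by simp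
      ultimately show ?thesis using orth' by meson
    qed
  qed
  thus ?thesis unfolding ip_def .
qed

section \<open>Exponentials on the unit cube\<close>

text \<open>\<open>lborel\<close> is the image of a product measure over \<open>Basis\<close>, which
  here consists of the vectors \<open>axis j 1\<close>; after this reindexing the claim is Fubini
  for products.\<close>

lemma lborel_prod_vec:
  fixes g :: "'d::finite \<Rightarrow> real \<Rightarrow> complex"
  assumes int: "\<And>j. integrable lborel (g j)"
  shows integrable_lborel_prod_vec: "integrable lborel (\<lambda>x::real^'d. \<Prod>j\<in>UNIV. g j (x $ j))" (is ?int)
    and integral_lborel_prod_vec:
      "(\<integral>x. (\<Prod>j\<in>UNIV. g j ((x::real^'d) $ j)) \<partial>lborel) = (\<Prod>j\<in>UNIV. \<integral>t. g j t \<partial>lborel)" (is ?eq)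
proof -
  interpret product_sigma_finite "\<lambda>_::real^'d. lborel :: real measure" ..
  have basis: "(Basis :: (real^'d) set) = range (\<lambda>j. axis j 1)"
    by (auto simp: Basis_vec_def)
  have inj: "inj (\<lambda>j::'d. axis j (1::real))"
    by (auto simp: inj_on_def axis_eq_axis)
  define h where "h b = g (inv (\<lambda>j. axis j (1::real)) b)" for b
  have h: "h (axis j 1) = g j" for j
    by (simp add: h_def inv_f_f[OF inj])
  have reindex: "(\<Prod>b\<in>Basis. F b) = (\<Prod>j\<in>UNIV. F (axis j 1))" for F :: "real^'d \<Rightarrow> complex"
    unfolding basis by (simp add: prod.reindex inj)
  have int_h: "integrable lborel (h b)" for b
    unfolding h_def by (rule int)
  have [measurable]: "g j \<in> borel_measurable borel" for j
    using borel_measurable_integrable[OF int[of j]] by simp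
  have comp: "(\<Prod>j\<in>UNIV. g j ((\<Sum>b\<in>Basis. f b *\<^sub>R b) $ j)) = (\<Prod>b\<in>Basis. h b (f b))"
    for f :: "real^'d \<Rightarrow> real"
  proof -
    have "(\<Sum>b\<in>Basis. f b *\<^sub>R b) $ j = f (axis j 1)" for j
      using inner_sum_left_Basis[of "axis j 1 :: real^'d" f]
      by (simp add: basis inner_axis del: sum_component)
    thus ?thesis by (simp add: reindex h del: sum_component)
  qed
  have meas: "(\<lambda>f. \<Sum>b\<in>Basis. f b *\<^sub>R b) \<in> (\<Pi>\<^sub>M b\<in>(Basis :: (real^'d) set). lborel) \<rightarrow>\<^sub>M borel"
    by measurable
  have meas_g: "(\<lambda>x::real^'d. \<Prod>j\<in>UNIV. g j (x $ j)) \<in> borel_measurable borel"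
    by measurable
  show ?int
    unfolding lborel_eq[where 'a = "real^'d"] integrable_distr_eq[OF meas meas_g] comp
    using int_h by (intro product_integrable_prod) auto
  show ?eq
    unfolding lborel_eq[where 'a = "real^'d"] integral_distr[OF meas meas_g] comp
    using int_h by (subst product_integral_prod) (auto simp: reindex h)
qed

abbreviation cube_measure :: "(real ^ 'd::finite) measure" where
  "cube_measure \<equiv> restrict_space lborel half_open_cube"

lemma half_open_cube_borel [measurable]: "half_open_cube \<in> sets borel"
  unfolding half_open_cube_def by measurable

lemma indicator_half_open_cube:
  "indicator half_open_cube (x :: real^'d::finite) = (\<Prod>j\<in>UNIV. indicator {0..<1} (x $ j) :: 'b::{comm_semiring_1})"
proof (cases "x \<in> half_open_cube")
  case False
  then obtain j where "x $ j \<notin> {0..<1}" by (auto simp: half_open_cube_def)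
  hence "(\<Prod>j\<in>UNIV. indicator {0..<1} (x $ j) :: 'b) = 0"
    by (intro prod_zero) (auto intro!: exI[of _ j] simp: indicator_def)
  thus ?thesis using False by simp
qed (auto simp: half_open_cube_def indicator_def)

lemma cube_prod:
  fixes g :: "'d::finite \<Rightarrow> real \<Rightarrow> complex"
  assumes int: "\<And>j. set_integrable lborel {0..<1} (g j)"
  shows integrable_cube_prod: "integrable cube_measure (\<lambda>x::real^'d. \<Prod>j\<in>UNIV. g j (x $ j))"
    and integral_cube_prod:
      "(\<integral>x. (\<Prod>j\<in>UNIV. g j ((x::real^'d) $ j)) \<partial>cube_measure)
        = (\<Prod>j\<in>UNIV. LINT t:{0..<1}|lborel. g j t)"
proof -
  have eq: "indicator half_open_cube x *\<^sub>R (\<Prod>j\<in>UNIV. g j (x $ j))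
      = (\<Prod>j\<in>UNIV. indicator {0..<1} (x $ j) *\<^sub>R g j (x $ j))" for x :: "real^'d"
    by (simp add: indicator_half_open_cube prod.distrib scaleR_conv_of_real)
  show "integrable cube_measure (\<lambda>x::real^'d. \<Prod>j\<in>UNIV. g j (x $ j))"
    using integrable_lborel_prod_vec[of "\<lambda>j t. indicator {0..<1} t *\<^sub>R g j t"] int
    by (simp add: integrable_restrict_space eq set_integrable_def)
  show "(\<integral>x. (\<Prod>j\<in>UNIV. g j ((x::real^'d) $ j)) \<partial>cube_measure)
      = (\<Prod>j\<in>UNIV. LINT t:{0..<1}|lborel. g j t)"
    using integral_lborel_prod_vec[of "\<lambda>j t. indicator {0..<1} t *\<^sub>R g j t"] int
    by (simp add: integral_restrict_space eq set_integrable_def set_lebesgue_integral_def)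
qed

lemma finite_measure_cube: "finite_measure (cube_measure :: (real^'d::finite) measure)"
  and measure_cube: "measure (cube_measure :: (real^'d::finite) measure) (space cube_measure) = 1"
proof -
  have "integrable cube_measure (\<lambda>x::real^'d. \<Prod>j\<in>(UNIV::'d set). 1::complex)"
    by (rule integrable_cube_prod) (simp add: set_integrable_def)
  hence "emeasure (cube_measure :: (real^'d) measure) (space cube_measure) < \<infinity>"
    by (simp add: integrable_iff_bounded)
  thus fin: "finite_measure (cube_measure :: (real^'d) measure)"
    by (intro finite_measureI) auto
  have "(\<integral>x. (\<Prod>j\<in>(UNIV::'d set). 1::complex) \<partial>(cube_measure :: (real^'d) measure)) = 1"
    by (subst integral_cube_prod) (auto simp: set_integrable_def set_lebesgue_integral_def)
  thus "measure (cube_measure :: (real^'d) measure) (space cube_measure) = 1"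
    by (simp add: scaleR_conv_of_real)
qed

lemma borel_measurable_cis [measurable]: "cis \<in> borel_measurable borel"
  by (intro borel_measurable_continuous_onI continuous_intros)

lemma cnj_borel_measurable [measurable]: "cnj \<in> borel_measurable borel"
  by (intro borel_measurable_continuous_onI continuous_intros)

lemma integral_cis:
  assumes "a \<le> b"
  shows "set_integrable lborel {a..<b} (\<lambda>t. cis (c * t))" (is ?int)
    and "c \<noteq> 0 \<Longrightarrow> (LINT t:{a..<b}|lborel. cis (c * t)) = (cis (c * b) - cis (c * a)) / (\<i> * of_real c)"
proof -
  show ?int
    unfolding set_integrable_def
    by (rule integrableI_bounded_set_indicator[where B = 1]) (use assms in auto)
  assume c: "c \<noteq> 0"
  have deriv: "((\<lambda>t. cis (c * t) / (\<i> * of_real c)) has_vector_derivative cis (c * t)) (at t within {a..b})" for t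
    unfolding has_vector_derivative_def
    by ((rule derivative_eq_intros refl)+, use c in \<open>auto simp: fun_eq_iff scaleR_conv_of_real\<close>)
      (simp add: complex_eq_iff)
  have "(LINT t:{a..<b}|lborel. cis (c * t)) = (LINT t|lborel. indicator {a..b} t *\<^sub>R cis (c * t))"
    unfolding set_lebesgue_integral_def
    by (intro integral_cong_AE) (use AE_lborel_singleton[of b] in \<open>auto elim!: eventually_mono simp: indicator_def\<close>)
  also have "\<dots> = cis (c * b) / (\<i> * of_real c) - cis (c * a) / (\<i> * of_real c)"
    using assms deriv by (intro integral_FTC_Icc) (auto intro!: continuous_intros)
  finally show "(LINT t:{a..<b}|lborel. cis (c * t)) = (cis (c * b) - cis (c * a)) / (\<i> * of_real c)"
    by (simp add: diff_divide_distrib)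
qed

text \<open>The exponential with frequency vector \<open>k\<close>, written as a product over
  coordinates so that its integrals over the cube factor.\<close>

definition character :: "int ^ 'd::finite \<Rightarrow> real ^ 'd \<Rightarrow> complex" where
  "character k x = (\<Prod>j\<in>UNIV. cis (2 * pi * of_int (k $ j) * x $ j))"

lemma norm_character [simp]: "norm (character k x) = 1"
  by (simp add: character_def flip: prod_norm)

lemma character_0 [simp]: "character 0 x = 1"
  by (simp add: character_def)

lemma character_cnj [simp]: "character k x * cnj (character k x) = 1"
  by (simp add: complex_norm_square[symmetric])

lemma character_diff: "character (k - l) x = character k x * cnj (character l x)"
  by (simp add: character_def cis_cnj cis_mult algebra_simps flip: prod.distrib)

lemma borel_measurable_character [measurable]: "character k \<in> borel_measurable borel"
  unfolding character_def[abs_def] by measurable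

lemma integrable_character: "integrable cube_measure (character k)"
  unfolding character_def by (intro integrable_cube_prod integral_cis) simp

lemma integral_character: "(\<integral>x. character k x \<partial>cube_measure) = (if k = 0 then 1 else 0)"
proof -
  have 1: "(LINT t:{0..<1}|lborel. cis (2 * pi * of_int n * t)) = (if n = 0 then 1 else 0)" for n :: int
  proof (cases "n = 0")
    case False
    thus ?thesis using integral_cis(2)[of 0 1 "2 * pi * of_int n"]
      by (simp add: cis_multiple_2pi)
  qed (simp add: set_lebesgue_integral_def)
  show ?thesis
    unfolding character_def
    by (subst integral_cube_prod)
       (auto simp: 1 vec_eq_iff intro!: integral_cis)
qed

lemma character_orthonormal:
  "(\<integral>x. character k x * cnj (character l x) \<partial>cube_measure) = (if k = l then 1 else 0)"
  "integrable cube_measure (\<lambda>x. character k x * cnj (character l x))"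
  using integral_character[of "k - l"] integrable_character[of "k - l"]
  by (simp_all add: character_diff[abs_def])

section \<open>Trigonometric polynomials vanishing at the knots\<close>

text \<open>
  The polynomial is \<open>1 - (card K)\<^sup>-\<^sup>1 \<Sum>\<^sub>i |\<langle>e(y), v\<^sub>i\<rangle>|\<^sup>2\<close>, where \<open>e(y)\<close> is the vector of all \<open>character k y\<close>
  with \<open>k \<in> K\<close> and the \<open>v\<^sub>i\<close> are an orthonormal basis of the span of the \<open>e(x \<mu>)\<close>: the squared
  distance of the normalized \<open>e(y)\<close> to this span, hence between 0 and 1 and zero at every \<open>x \<mu>\<close>.
\<close>

lemma fooling_polynomial:
  fixes x :: "nat \<Rightarrow> real ^ 'd::finite" and K :: "(int ^ 'd) set"
  assumes fin: "finite K" and card: "0 < card K" "2 * m \<le> card K"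
  shows "\<exists>c :: int ^ 'd \<Rightarrow> complex.
    (\<forall>\<kappa>. c \<kappa> \<noteq> 0 \<longrightarrow> \<kappa> \<in> (\<lambda>(k, l). k - l) ` (K \<times> K))
    \<and> 1 / 2 \<le> Re (c 0)
    \<and> (\<Sum>\<kappa>\<in>(\<lambda>(k, l). k - l) ` (K \<times> K). (cmod (c \<kappa>))\<^sup>2) \<le> 1
    \<and> (\<forall>\<mu><m. (\<Sum>\<kappa>\<in>(\<lambda>(k, l). k - l) ` (K \<times> K). c \<kappa> * character \<kappa> (x \<mu>)) = 0)"
proof -
  define \<Delta> where "\<Delta> = (\<lambda>(k, l). k - l) ` (K \<times> K)"
  have fin_\<Delta>: "finite \<Delta>" using fin by (simp add: \<Delta>_def)
  have \<Delta>I: "k - l \<in> \<Delta>" if "k \<in> K" "l \<in> K" for k l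
    using that by (auto simp: \<Delta>_def)
  have "K \<noteq> {}" using card by auto
  hence zero_\<Delta>: "0 \<in> \<Delta>" using \<Delta>I by (metis all_not_in_conv cancel_comm_monoid_add_class.diff_cancel)
  define D where "D = real (card K)"
  have D: "D > 0" using card by (simp add: D_def)
  obtain q v where q: "q \<le> m"
    and orth: "\<And>i j. i < q \<Longrightarrow> j < q \<Longrightarrow> (\<Sum>k\<in>K. v i k * cnj (v j k)) = (if i = j then 1 else 0)"
    and span: "\<And>\<mu> k. \<mu> < m \<Longrightarrow> k \<in> K \<Longrightarrow>
      character k (x \<mu>) = (\<Sum>i<q. (\<Sum>l\<in>K. character l (x \<mu>) * cnj (v i l)) * v i k)"
    using gram_schmidt[OF fin, of m "\<lambda>\<mu> k. character k (x \<mu>)"] by blast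
  \<comment> \<open>Inner product of \<open>e(y)\<close> with \<open>v i\<close>, as a function of
    \<open>y\<close>.\<close>
  define p where "p i y = (\<Sum>k\<in>K. character k y * cnj (v i k))" for i y
  define F where "F y = 1 - (\<Sum>i<q. (cmod (p i y))\<^sup>2) / D" for y
  \<comment> \<open>Fourier coefficients of \<open>|p i|^2\<close>: pairs of frequencies are grouped
    by their difference, which is why the support is \<open>\<Delta>\<close>.\<close>
  define A where "A i \<kappa> = (\<Sum>k\<in>K. \<Sum>l\<in>K. if k - l = \<kappa> then cnj (v i k) * v i l else 0)" for i \<kappa>
  define c where "c \<kappa> = (if \<kappa> = 0 then 1 else 0) - (\<Sum>i<q. A i \<kappa>) / of_real D" for \<kappa>
  have A_eq: "(\<Sum>\<kappa>\<in>\<Delta>. A i \<kappa> * character \<kappa> y) = of_real ((cmod (p i y))\<^sup>2)" for i y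
  proof -
    have "(\<Sum>\<kappa>\<in>\<Delta>. A i \<kappa> * character \<kappa> y)
        = (\<Sum>\<kappa>\<in>\<Delta>. \<Sum>k\<in>K. \<Sum>l\<in>K. if k - l = \<kappa> then cnj (v i k) * v i l * character \<kappa> y else 0)"
      unfolding A_def sum_distrib_right by (intro sum.cong refl) auto
    also have "\<dots> = (\<Sum>k\<in>K. \<Sum>l\<in>K. \<Sum>\<kappa>\<in>\<Delta>. if k - l = \<kappa> then cnj (v i k) * v i l * character \<kappa> y else 0)"
      by (subst sum.swap, rule sum.cong[OF refl], rule sum.swap)
    also have "\<dots> = (\<Sum>k\<in>K. \<Sum>l\<in>K. cnj (v i k) * v i l * character (k - l) y)"
      using fin_\<Delta> \<Delta>I by (intro sum.cong refl) simp
    also have "\<dots> = p i y * cnj (p i y)"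
      unfolding p_def cnj_sum sum_product character_diff by (intro sum.cong refl) simp
    finally show ?thesis by (simp only: complex_norm_square)
  qed
  have c_eq: "(\<Sum>\<kappa>\<in>\<Delta>. c \<kappa> * character \<kappa> y) = of_real (F y)" for y
  proof -
    have "(\<Sum>\<kappa>\<in>\<Delta>. c \<kappa> * character \<kappa> y)
        = (\<Sum>\<kappa>\<in>\<Delta>. if \<kappa> = 0 then character \<kappa> y else 0) - (\<Sum>\<kappa>\<in>\<Delta>. \<Sum>i<q. A i \<kappa> * character \<kappa> y) / of_real D"
      unfolding c_def sum_divide_distrib sum_subtractf[symmetric]
      by (intro sum.cong refl) (simp add: algebra_simps sum_distrib_left sum_distrib_right sum_divide_distrib)
    also have "(\<Sum>\<kappa>\<in>\<Delta>. \<Sum>i<q. A i \<kappa> * character \<kappa> y) = (\<Sum>i<q. of_real ((cmod (p i y))\<^sup>2))"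
      by (subst sum.swap) (simp only: A_eq)
    finally show ?thesis using fin_\<Delta> zero_\<Delta> by (simp add: F_def)
  qed
  have F_le: "F y \<le> 1" for y
    using D by (simp add: F_def sum_nonneg)
  \<comment> \<open>Bessel for the counting measure on \<open>K\<close>: all coordinates of
    \<open>e(y)\<close> have modulus 1, so its squared norm is \<open>D\<close>.\<close>
  have F_ge: "0 \<le> F y" for y
  proof -
    have "(\<Sum>i<q. (cmod (\<integral>k. character k y * cnj (v i k) \<partial>count_space K))\<^sup>2)
        \<le> (\<integral>k. (cmod (character k y))\<^sup>2 \<partial>count_space K)"
      using fin orth
      by (intro bessel_inequality) (auto simp: integrable_count_space lebesgue_integral_count_space_finite)
    hence "(\<Sum>i<q. (cmod (p i y))\<^sup>2) \<le> D"
      using fin by (simp add: lebesgue_integral_count_space_finite p_def D_def)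
    thus ?thesis using D by (simp add: F_def)
  qed
  \<comment> \<open>At a knot, \<open>e(x \<mu>)\<close> lies in the span of the \<open>v i\<close>,
    and Bessel becomes an equality.\<close>
  have F_zero: "F (x \<mu>) = 0" if "\<mu> < m" for \<mu>
  proof -
    have "complex_of_real D = (\<Sum>k\<in>K. character k (x \<mu>) * cnj (character k (x \<mu>)))"
      by (simp add: D_def)
    also have "\<dots> = (\<Sum>k\<in>K. (\<Sum>i<q. p i (x \<mu>) * v i k) * cnj (character k (x \<mu>)))"
      using span[OF that] unfolding p_def by (intro sum.cong refl) simp
    also have "\<dots> = (\<Sum>i<q. \<Sum>k\<in>K. p i (x \<mu>) * (v i k * cnj (character k (x \<mu>))))"
      unfolding sum_distrib_right by (subst sum.swap) (simp add: mult.assoc)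
    also have "\<dots> = (\<Sum>i<q. p i (x \<mu>) * cnj (p i (x \<mu>)))"
      unfolding sum_distrib_left[symmetric] by (simp add: p_def mult.commute)
    also have "\<dots> = of_real (\<Sum>i<q. (cmod (p i (x \<mu>)))\<^sup>2)"
      unfolding of_real_sum complex_norm_square ..
    finally have "D = (\<Sum>i<q. (cmod (p i (x \<mu>)))\<^sup>2)" by (simp only: of_real_eq_iff)
    thus ?thesis using D by (simp add: F_def)
  qed
  \<comment> \<open>Orthonormality identifies \<open>c\<close> with the Fourier coefficients of
    \<open>F\<close>, and \<open>0 <= F <= 1\<close> bounds the squared norm of \<open>F\<close> by
    1.\<close>
  have "(\<Sum>\<kappa>\<in>\<Delta>. (cmod (c \<kappa>))\<^sup>2) \<le> 1"
  proof -
    interpret finite_measure "cube_measure :: (real^'d) measure" by (rule finite_measure_cube)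
    have F_meas [measurable]: "(\<lambda>y. complex_of_real (F y)) \<in> borel_measurable cube_measure"
      unfolding c_eq[symmetric] by (intro measurable_restrict_space1) simp
    have F_bd: "cmod (of_real (F y)) \<le> 1" for y
      using F_le[of y] F_ge[of y] by simp
    have meas_char [measurable]: "character k \<in> borel_measurable cube_measure" for k :: "int^'d"
      by (intro measurable_restrict_space1) simp
    have int_eq: "(\<integral>y. complex_of_real (F y) * cnj (character \<kappa> y) \<partial>cube_measure) = c \<kappa>"
      if "\<kappa> \<in> \<Delta>" for \<kappa>
    proof -
      have "(\<integral>y. complex_of_real (F y) * cnj (character \<kappa> y) \<partial>cube_measure)
          = (\<integral>y. (\<Sum>l\<in>\<Delta>. c l * (character l y * cnj (character \<kappa> y))) \<partial>cube_measure)"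
        unfolding c_eq[symmetric] sum_distrib_right by (simp add: mult.assoc)
      also have "\<dots> = (\<Sum>l\<in>\<Delta>. c l * (if l = \<kappa> then 1 else 0))"
        by (subst Bochner_Integration.integral_sum) (auto simp: character_orthonormal)
      also have "\<dots> = (\<Sum>l\<in>\<Delta>. if l = \<kappa> then c l else 0)"
        by (intro sum.cong) auto
      finally show ?thesis using that fin_\<Delta> by simp
    qed
    have "(\<Sum>\<kappa>\<in>\<Delta>. (cmod (c \<kappa>))\<^sup>2)
        = (\<Sum>\<kappa>\<in>\<Delta>. (cmod (\<integral>y. complex_of_real (F y) * cnj (character \<kappa> y) \<partial>cube_measure))\<^sup>2)"
      using int_eq by simp
    also have "\<dots> \<le> (\<integral>y. (cmod (complex_of_real (F y)))\<^sup>2 \<partial>(cube_measure :: (real^'d) measure))"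
    proof (rule bessel_inequality[OF fin_\<Delta>])
      show "integrable cube_measure (\<lambda>y. (cmod (complex_of_real (F y)))\<^sup>2)"
      proof (rule integrable_const_bound[where B = 1])
        show "AE y in cube_measure. norm ((cmod (complex_of_real (F y)))\<^sup>2) \<le> 1"
          using F_bd by (intro AE_I2) (simp add: abs_square_le_1)
      qed measurable
      show "integrable cube_measure (\<lambda>y. complex_of_real (F y) * cnj (character k y))" for k
      proof (rule integrable_const_bound[where B = 1])
        show "AE y in cube_measure. norm (complex_of_real (F y) * cnj (character k y)) \<le> 1"
          using F_bd by (intro AE_I2) (simp add: norm_mult)
      qed measurable
    qed (simp_all add: character_orthonormal)
    also have "\<dots> \<le> (\<integral>y. 1 \<partial>(cube_measure :: (real^'d) measure))"
      using F_bd by (intro integral_mono') (simp_all add: abs_square_le_1)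
    also have "\<dots> = 1" using measure_cube[where 'd = 'd] by simp
    finally show ?thesis .
  qed
  moreover have "1 / 2 \<le> Re (c 0)"
  proof -
    \<comment> \<open>Each unit vector \<open>v i\<close> contributes exactly 1 at frequency 0, so
      the mean is \<open>1 - q / D\<close> with \<open>2 * q <= 2 * m <= D\<close>.\<close>
    have "A i 0 = 1" if "i < q" for i
    proof -
      have "A i 0 = (\<Sum>k\<in>K. cnj (v i k) * v i k)"
        unfolding A_def using fin by (intro sum.cong refl) (simp add: sum.delta')
      thus ?thesis using orth[OF that that] by (simp add: mult.commute)
    qed
    hence "Re (c 0) = 1 - real q / D" by (simp add: c_def)
    moreover have "2 * real q \<le> D" using q card(2) by (simp add: D_def)
    ultimately have "real q / D \<le> 1 / 2" "Re (c 0) = 1 - real q / D" using D by (simp_all add: field_simps)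
    thus ?thesis by linarith
  qed
  moreover have "\<kappa> \<in> \<Delta>" if "c \<kappa> \<noteq> 0" for \<kappa>
  proof (rule ccontr)
    assume "\<kappa> \<notin> \<Delta>"
    hence "A i \<kappa> = 0" for i unfolding A_def using \<Delta>I by (intro sum.neutral ballI) auto
    with that \<open>\<kappa> \<notin> \<Delta>\<close> zero_\<Delta> show False by (auto simp: c_def split: if_splits)
  qed
  ultimately show ?thesis
    using c_eq F_zero unfolding \<Delta>_def[symmetric] by (intro exI[of _ c]) auto
qed

section \<open>Dyadic boxes and the sum of their polynomials\<close>

lemma card_dyadic_box:
  fixes s :: "'d::finite \<Rightarrow> nat"
  shows "finite {k :: int^'d. \<forall>j. 0 \<le> k $ j \<and> k $ j < 2 ^ s j}" (is ?fin)
    and "card {k :: int^'d. \<forall>j. 0 \<le> k $ j \<and> k $ j < 2 ^ s j} = 2 ^ (\<Sum>j\<in>UNIV. s j)" (is ?card)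
proof -
  have eq: "{k :: int^'d. \<forall>j. 0 \<le> k $ j \<and> k $ j < 2 ^ s j} = vec_lambda ` (PiE UNIV (\<lambda>j. {0..<2 ^ s j}))"
    by (auto simp: image_iff PiE_UNIV_domain intro!: bexI[of _ "\<lambda>j. _ $ j"])
  have inj: "inj_on (vec_lambda :: ('d \<Rightarrow> int) \<Rightarrow> int^'d) A" for A
    by (auto simp: inj_on_def vec_lambda_inject)
  show ?fin unfolding eq by (intro finite_imageI finite_PiE) auto
  show ?card unfolding eq by (simp add: card_image inj card_PiE power_sum nat_power_eq)
qed

lemma finite_int_box: "finite {k :: int^'d::finite. \<forall>j. \<bar>k $ j\<bar> \<le> N}"
proof -
  have "k \<in> vec_lambda ` (PiE UNIV (\<lambda>j. {-N..N}))" if "\<forall>j. \<bar>k $ j\<bar> \<le> N" for k :: "int^'d"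
    using that by (intro image_eqI[of _ _ "vec_nth k"]) (auto simp: abs_le_iff minus_le_iff)
  hence "{k :: int^'d. \<forall>j. \<bar>k $ j\<bar> \<le> N} \<subseteq> vec_lambda ` (PiE UNIV (\<lambda>j. {-N..N}))" by auto
  thus ?thesis by (rule finite_subset) (intro finite_imageI finite_PiE, auto)
qed

text \<open>\<open>max a b - min a b\<close> is the distance of \<open>a\<close> and
  \<open>b\<close> in \<open>nat\<close>. Each side of \<open>a\<close> contributes a geometric
  series of sum at most 2; counting \<open>b = a\<close> twice does no harm.\<close>

lemma sum_half_power_dist_le: "(\<Sum>b\<le>n. (1 / 2 :: real) ^ (max a b - min a b)) \<le> 4"
proof -
  have geom: "(\<Sum>i\<le>k. (1 / 2 :: real) ^ i) \<le> 2" for k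
  proof -
    have "(\<Sum>i\<le>k. (1 / 2 :: real) ^ i) = 2 - (1 / 2) ^ k" by (induction k) (auto simp: field_simps)
    thus ?thesis by simp
  qed
  have "(\<Sum>b\<le>n. (1 / 2 :: real) ^ (max a b - min a b))
      \<le> (\<Sum>b\<in>{..a} \<union> {a..a + n}. (1 / 2 :: real) ^ (max a b - min a b))"
    by (intro sum_mono2) auto
  also have "\<dots> \<le> (\<Sum>b\<le>a. (1 / 2 :: real) ^ (max a b - min a b))
      + (\<Sum>b\<in>{a..a + n}. (1 / 2 :: real) ^ (max a b - min a b))"
    by (subst sum_Un) (auto intro!: sum_nonneg)
  also have "(\<Sum>b\<le>a. (1 / 2 :: real) ^ (max a b - min a b)) = (\<Sum>i\<le>a. (1 / 2) ^ i)"
    by (rule sum.reindex_bij_witness[of _ "\<lambda>i. a - i" "\<lambda>i. a - i"]) auto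
  also have "(\<Sum>b\<in>{a..a + n}. (1 / 2 :: real) ^ (max a b - min a b)) = (\<Sum>i\<le>n. (1 / 2) ^ i)"
    by (rule sum.reindex_bij_witness[of _ "\<lambda>i. a + i" "\<lambda>i. i - a"]) auto
  finally show ?thesis using geom[of a] geom[of n] by linarith
qed

text \<open>Since \<open>2 * min a b = a + b - |a - b|\<close>, the left side is the right side with
  the decay \<open>2^(-r * |a - b|)\<close> instead of \<open>2^(-|a - b|)\<close>;
  \<open>r >= 1\<close> permits the weakening.\<close>

lemma power_min_le:
  assumes "r \<ge> 1"
  shows "((2::real) ^ min a b) ^ (2 * r) \<le> (2 ^ r) ^ a * (2 ^ r) ^ b * (1 / 2) ^ (max a b - min a b)"
proof -
  have *: "((2::real) ^ a) ^ (2 * r) \<le> (2 ^ r) ^ a * (2 ^ r) ^ (a + e) * (1 / 2) ^ e" for a e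
  proof -
    have "((2::real) ^ a) ^ (2 * r) * 1 \<le> ((2::real) ^ a) ^ (2 * r) * ((2 ^ r) / 2) ^ e"
      using assms power_increasing[of 1 r "2::real"] by (intro mult_left_mono one_le_power) auto
    also have "\<dots> = (2 ^ r) ^ a * (2 ^ r) ^ (a + e) * (1 / 2) ^ e"
    proof -
      have "((2::real) ^ a) ^ (2 * r) = (2 ^ r) ^ a * (2 ^ r) ^ a"
        by (simp only: power_mult[symmetric] power_add[symmetric]) (simp add: algebra_simps)
      thus ?thesis by (simp add: power_add power_divide)
    qed
    finally show ?thesis by simp
  qed
  show ?thesis
  proof (cases "a \<le> b")
    case True
    thus ?thesis using *[of a "b - a"] by (simp add: min_def max_def)
  next
    case False
    thus ?thesis using *[of b "a - b"] by (simp add: min_def max_def mult.commute)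
  qed
qed

text \<open>Weight of the squared norm of a periodic Sobolev space of dominating mixed smoothness
  \<open>r\<close>. The discrepancy is compared with the dual norm, whose weight is the
  reciprocal.\<close>

definition freq_weight :: "nat \<Rightarrow> int ^ 'd::finite \<Rightarrow> real" where
  "freq_weight r \<kappa> = (\<Prod>j\<in>UNIV. (max 1 \<bar>of_int (\<kappa> $ j)\<bar>) ^ (2 * r))"

lemma freq_weight_pos: "freq_weight r \<kappa> > 0"
  unfolding freq_weight_def by (intro prod_pos) auto

lemma freq_weight_neq_0 [simp]: "freq_weight r \<kappa> \<noteq> 0"
  and freq_weight_nonneg [simp]: "0 \<le> freq_weight r \<kappa>"
  using freq_weight_pos[of r \<kappa>] by simp_all

text \<open>
  The sum of the polynomials belonging to all dyadic boxes of volume \<open>2\<^sup>n\<close>. The product of the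
  polynomials of the boxes \<open>s\<close> and \<open>t\<close> only involves frequencies below \<open>2\<close> to the power
  \<open>min s\<^sub>j t\<^sub>j\<close>, which makes the cross terms of the weighted norm decay geometrically in
  \<open>|s - t|\<^sub>1\<close>, so that the norm grows only like the number of boxes.
\<close>

lemma fooling_polynomial_hyperbolic:
  fixes x :: "nat \<Rightarrow> real ^ 'd::finite" and S :: "('d \<Rightarrow> nat) set"
  assumes r: "r \<ge> 1" and fin: "finite S" and S: "\<And>s. s \<in> S \<Longrightarrow> (\<Sum>j\<in>UNIV. s j) = n"
    and m: "2 * m \<le> 2 ^ n"
  defines "P \<equiv> {\<kappa> :: int ^ 'd. \<forall>j. \<bar>\<kappa> $ j\<bar> \<le> 2 ^ n}"
  shows "\<exists>c :: int ^ 'd \<Rightarrow> complex.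
      real (card S) / 2 \<le> Re (c 0)
    \<and> (\<Sum>\<kappa>\<in>P. freq_weight r \<kappa> * (cmod (c \<kappa>))\<^sup>2) \<le> 4 ^ (r * n) * 4 ^ CARD('d) * real (card S)
    \<and> (\<forall>\<mu><m. (\<Sum>\<kappa>\<in>P. c \<kappa> * character \<kappa> (x \<mu>)) = 0)"
proof -
  have fin_P: "finite P" unfolding P_def by (rule finite_int_box)
  have s_le: "s j \<le> n" if "s \<in> S" for s j
    using S[OF that] member_le_sum[of j UNIV s] by simp
  \<comment> \<open>All polynomials are placed on the common box \<open>P\<close>, where the
    additional coefficients vanish, so that they can be added.\<close>
  have "\<forall>s\<in>S. \<exists>c :: int ^ 'd \<Rightarrow> complex.
      (\<forall>\<kappa>. c \<kappa> \<noteq> 0 \<longrightarrow> (\<forall>j. \<bar>\<kappa> $ j\<bar> < 2 ^ s j))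
    \<and> 1 / 2 \<le> Re (c 0)
    \<and> (\<Sum>\<kappa>\<in>P. (cmod (c \<kappa>))\<^sup>2) \<le> 1
    \<and> (\<forall>\<mu><m. (\<Sum>\<kappa>\<in>P. c \<kappa> * character \<kappa> (x \<mu>)) = 0)"
  proof
    fix s assume s: "s \<in> S"
    define K where "K = {k :: int^'d. \<forall>j. 0 \<le> k $ j \<and> k $ j < 2 ^ s j}"
    define \<Delta> where "\<Delta> = (\<lambda>(k, l). k - l) ` (K \<times> K)"
    have K: "finite K" "card K = 2 ^ n"
      using card_dyadic_box[of s] S[OF s] by (simp_all add: K_def)
    have \<Delta>_less: "\<bar>\<kappa> $ j\<bar> < 2 ^ s j" if \<kappa>: "\<kappa> \<in> \<Delta>" for \<kappa> j
      proof -
      obtain k l where kl: "\<kappa> = k - l" and "k \<in> K" "l \<in> K"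
        using \<kappa> unfolding \<Delta>_def by (elim imageE SigmaE) simp
      hence "0 \<le> k $ j \<and> k $ j < 2 ^ s j" "0 \<le> l $ j \<and> l $ j < 2 ^ s j"
        by (simp_all add: K_def)
      thus ?thesis unfolding kl vector_minus_component by linarith
    qed
    have "\<bar>\<kappa> $ j\<bar> \<le> 2 ^ n" if "\<kappa> \<in> \<Delta>" for \<kappa> j
    proof -
      have "(2::int) ^ s j \<le> 2 ^ n" using s_le[OF s] by (intro power_increasing) auto
      thus ?thesis using \<Delta>_less[OF that, of j] by linarith
    qed
    hence \<Delta>_P: "\<Delta> \<subseteq> P" by (auto simp: P_def)
    obtain c :: "int ^ 'd \<Rightarrow> complex" where c: "\<And>\<kappa>. c \<kappa> \<noteq> 0 \<Longrightarrow> \<kappa> \<in> \<Delta>" "1 / 2 \<le> Re (c 0)"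
      "(\<Sum>\<kappa>\<in>\<Delta>. (cmod (c \<kappa>))\<^sup>2) \<le> 1"
      "\<And>\<mu>. \<mu> < m \<Longrightarrow> (\<Sum>\<kappa>\<in>\<Delta>. c \<kappa> * character \<kappa> (x \<mu>)) = 0"
      using fooling_polynomial[OF K(1), of m x] K(2) m unfolding \<Delta>_def by auto
    have "(\<Sum>\<kappa>\<in>P. (cmod (c \<kappa>))\<^sup>2) = (\<Sum>\<kappa>\<in>\<Delta>. (cmod (c \<kappa>))\<^sup>2)"
      using c(1) by (intro sum.mono_neutral_right[OF fin_P \<Delta>_P]) auto
    moreover have "(\<Sum>\<kappa>\<in>P. c \<kappa> * character \<kappa> (x \<mu>)) = (\<Sum>\<kappa>\<in>\<Delta>. c \<kappa> * character \<kappa> (x \<mu>))" for \<mu>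
      using c(1) by (intro sum.mono_neutral_right[OF fin_P \<Delta>_P]) auto
    ultimately show "\<exists>c :: int ^ 'd \<Rightarrow> complex.
      (\<forall>\<kappa>. c \<kappa> \<noteq> 0 \<longrightarrow> (\<forall>j. \<bar>\<kappa> $ j\<bar> < 2 ^ s j))
    \<and> 1 / 2 \<le> Re (c 0)
    \<and> (\<Sum>\<kappa>\<in>P. (cmod (c \<kappa>))\<^sup>2) \<le> 1
    \<and> (\<forall>\<mu><m. (\<Sum>\<kappa>\<in>P. c \<kappa> * character \<kappa> (x \<mu>)) = 0)"
      using c \<Delta>_less by (intro exI[of _ c] conjI allI impI) simp_all
  qed
  from bchoice[OF this] obtain c where c_supp: "\<And>s \<kappa> j. s \<in> S \<Longrightarrow> c s \<kappa> \<noteq> 0 \<Longrightarrow> \<bar>\<kappa> $ j\<bar> < 2 ^ s j"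
    and c_0: "\<And>s. s \<in> S \<Longrightarrow> 1 / 2 \<le> Re (c s 0)"
    and c_sq: "\<And>s. s \<in> S \<Longrightarrow> (\<Sum>\<kappa>\<in>P. (cmod (c s \<kappa>))\<^sup>2) \<le> 1"
    and c_zero: "\<And>s \<mu>. s \<in> S \<Longrightarrow> \<mu> < m \<Longrightarrow> (\<Sum>\<kappa>\<in>P. c s \<kappa> * character \<kappa> (x \<mu>)) = 0"
    by blast
  define \<delta> where "\<delta> a b = (1 / 2 :: real) ^ (max a b - min a b)" for a b :: nat
  \<comment> \<open>Both coefficients are nonzero only if each \<open>|\<kappa> $ j|\<close> is
    below \<open>2 ^ min (s j) (t j)\<close>, which bounds the weight by \<open>B\<close>. The
    remaining sum is at most 1 by \<open>2ab <= a^2 + b^2\<close> and \<open>c_sq\<close>. Since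
    both exponent vectors sum to \<open>n\<close>, \<open>power_min_le\<close> then produces
    \<open>4 ^ (r * n)\<close>.\<close>
  have cross: "(\<Sum>\<kappa>\<in>P. freq_weight r \<kappa> * (cmod (c s \<kappa>) * cmod (c t \<kappa>)))
      \<le> 4 ^ (r * n) * (\<Prod>j\<in>UNIV. \<delta> (s j) (t j))" if s: "s \<in> S" and t: "t \<in> S" for s t
  proof -
    define B where "B = (\<Prod>j\<in>UNIV. ((2::real) ^ min (s j) (t j)) ^ (2 * r))"
    have "freq_weight r \<kappa> * (cmod (c s \<kappa>) * cmod (c t \<kappa>)) \<le> B * (((cmod (c s \<kappa>))\<^sup>2 + (cmod (c t \<kappa>))\<^sup>2) / 2)" for \<kappa>
    proof (cases "c s \<kappa> = 0 \<or> c t \<kappa> = 0")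
      case True
      thus ?thesis by (auto simp: B_def intro!: mult_nonneg_nonneg prod_nonneg)
    next
      case False
      have "max 1 \<bar>real_of_int (\<kappa> $ j)\<bar> \<le> 2 ^ min (s j) (t j)" for j
      proof -
        have "\<bar>\<kappa> $ j\<bar> < 2 ^ min (s j) (t j)"
          using c_supp[OF s, of \<kappa> j] c_supp[OF t, of \<kappa> j] False by (auto simp: min_def)
        hence "real_of_int \<bar>\<kappa> $ j\<bar> < real_of_int (2 ^ min (s j) (t j))" by (simp only: of_int_less_iff)
        thus ?thesis by simp
      qed
      hence "freq_weight r \<kappa> \<le> B"
        unfolding freq_weight_def B_def by (intro prod_mono conjI power_mono) auto
      moreover have "cmod (c s \<kappa>) * cmod (c t \<kappa>) \<le> ((cmod (c s \<kappa>))\<^sup>2 + (cmod (c t \<kappa>))\<^sup>2) / 2"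
        using sum_squares_bound[of "cmod (c s \<kappa>)" "cmod (c t \<kappa>)"] by simp
      ultimately show ?thesis
        using freq_weight_pos[of r \<kappa>] by (intro mult_mono) auto
    qed
    hence "(\<Sum>\<kappa>\<in>P. freq_weight r \<kappa> * (cmod (c s \<kappa>) * cmod (c t \<kappa>)))
        \<le> (\<Sum>\<kappa>\<in>P. B * (((cmod (c s \<kappa>))\<^sup>2 + (cmod (c t \<kappa>))\<^sup>2) / 2))"
      by (rule sum_mono)
    also have "\<dots> = B * (((\<Sum>\<kappa>\<in>P. (cmod (c s \<kappa>))\<^sup>2) + (\<Sum>\<kappa>\<in>P. (cmod (c t \<kappa>))\<^sup>2)) / 2)"
      by (simp only: sum_distrib_left[symmetric] sum_divide_distrib[symmetric] sum.distrib)
    also have "\<dots> \<le> B * 1"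
      using c_sq[OF s] c_sq[OF t] by (intro mult_left_mono) (auto simp: B_def intro!: prod_nonneg)
    also have "B \<le> (\<Prod>j\<in>UNIV. (2 ^ r) ^ s j * (2 ^ r) ^ t j * \<delta> (s j) (t j))"
      unfolding B_def \<delta>_def using power_min_le[OF r] by (intro prod_mono) auto
    also have "\<dots> = 4 ^ (r * n) * (\<Prod>j\<in>UNIV. \<delta> (s j) (t j))"
    proof -
      have "((2::real) ^ r) ^ n * (2 ^ r) ^ n = 4 ^ (r * n)"
        by (simp only: power_mult[symmetric] power_mult_distrib[symmetric]) simp
      thus ?thesis by (simp only: prod.distrib power_sum[symmetric] S[OF s] S[OF t])
    qed
    finally show ?thesis by simp
  qed
  \<comment> \<open>Dropping the condition that \<open>t\<close> sums to \<open>n\<close> turns the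
    sum over \<open>S\<close> into a full product sum, which factors into one-dimensional
    sums.\<close>
  have \<delta>_sum: "(\<Sum>t\<in>S. \<Prod>j\<in>UNIV. \<delta> (s j) (t j)) \<le> 4 ^ CARD('d)" for s
  proof -
    have "(\<Sum>t\<in>S. \<Prod>j\<in>UNIV. \<delta> (s j) (t j)) \<le> (\<Sum>t\<in>PiE UNIV (\<lambda>_. {..n}). \<Prod>j\<in>UNIV. \<delta> (s j) (t j))"
      using s_le by (intro sum_mono2 finite_PiE) (auto simp: PiE_UNIV_domain \<delta>_def intro!: prod_nonneg)
    also have "\<dots> = (\<Prod>j\<in>UNIV. \<Sum>b\<le>n. \<delta> (s j) b)"
      by (rule prod_sum_PiE[symmetric]) auto
    also have "\<dots> \<le> (\<Prod>j\<in>(UNIV::'d set). 4)"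
      using sum_half_power_dist_le by (intro prod_mono) (auto simp: \<delta>_def intro!: sum_nonneg)
    finally show ?thesis by simp
  qed
  define C where "C \<kappa> = (\<Sum>s\<in>S. c s \<kappa>)" for \<kappa>
  have "real (card S) / 2 \<le> Re (C 0)"
    using sum_mono[OF c_0, of S] by (simp add: C_def)
  moreover have "(\<Sum>\<kappa>\<in>P. C \<kappa> * character \<kappa> (x \<mu>)) = 0" if "\<mu> < m" for \<mu>
    unfolding C_def sum_distrib_right using that c_zero by (subst sum.swap) simp
  moreover have "(\<Sum>\<kappa>\<in>P. freq_weight r \<kappa> * (cmod (C \<kappa>))\<^sup>2) \<le> 4 ^ (r * n) * 4 ^ CARD('d) * real (card S)"
  proof -
    have "(\<Sum>\<kappa>\<in>P. freq_weight r \<kappa> * (cmod (C \<kappa>))\<^sup>2)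
        \<le> (\<Sum>\<kappa>\<in>P. freq_weight r \<kappa> * (\<Sum>s\<in>S. cmod (c s \<kappa>))\<^sup>2)"
      unfolding C_def using freq_weight_pos
      by (intro sum_mono mult_left_mono power_mono norm_sum) (auto intro: less_imp_le)
    also have "\<dots> = (\<Sum>\<kappa>\<in>P. \<Sum>s\<in>S. \<Sum>t\<in>S. freq_weight r \<kappa> * (cmod (c s \<kappa>) * cmod (c t \<kappa>)))"
      by (simp only: power2_eq_square sum_product) (simp only: sum_distrib_left)
    also have "\<dots> = (\<Sum>s\<in>S. \<Sum>t\<in>S. \<Sum>\<kappa>\<in>P. freq_weight r \<kappa> * (cmod (c s \<kappa>) * cmod (c t \<kappa>)))"
      by (subst sum.swap, rule sum.cong[OF refl], rule sum.swap)
    also have "\<dots> \<le> (\<Sum>s\<in>S. \<Sum>t\<in>S. 4 ^ (r * n) * (\<Prod>j\<in>UNIV. \<delta> (s j) (t j)))"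
      using cross by (intro sum_mono) auto
    also have "\<dots> = (\<Sum>s\<in>S. 4 ^ (r * n) * (\<Sum>t\<in>S. \<Prod>j\<in>UNIV. \<delta> (s j) (t j)))"
      by (simp add: sum_distrib_left)
    also have "\<dots> \<le> (\<Sum>s\<in>S. 4 ^ (r * n) * 4 ^ CARD('d))"
      using \<delta>_sum by (intro sum_mono mult_left_mono) auto
    finally show ?thesis by (simp add: mult.commute)
  qed
  ultimately show ?thesis by (intro exI[of _ C]) auto
qed

text \<open>All coordinates but one range freely over \<open>{..n div d}\<close>; their sum stays
  below \<open>n\<close>, and the last coordinate takes up the rest.\<close>

lemma many_compositions:
  "\<exists>S :: ('d::finite \<Rightarrow> nat) set. finite S \<and> (\<forall>s\<in>S. (\<Sum>j\<in>UNIV. s j) = n)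
    \<and> (real n / real CARD('d)) ^ (CARD('d) - 1) \<le> real (card S)"
proof -
  define d where "d = CARD('d)"
  have d: "d > 0" by (simp add: d_def)
  obtain j0 :: 'd where True by simp
  define T where "T = PiE (UNIV - {j0}) (\<lambda>_::'d. {..n div d})"
  define \<phi> where "\<phi> g = (\<lambda>j. if j = j0 then n - (\<Sum>i\<in>UNIV - {j0}. g i) else g j)" for g :: "'d \<Rightarrow> nat"
  have inj: "inj_on \<phi> T"
  proof (rule inj_onI)
    fix g h assume "g \<in> T" "h \<in> T" and eq: "\<phi> g = \<phi> h"
    show "g = h"
    proof
      \<comment> \<open>At \<open>j0\<close> both functions are \<open>undefined\<close>, being
        extensional on the other coordinates.\<close>
      fix j show "g j = h j"
        using fun_cong[OF eq, of j] \<open>g \<in> T\<close> \<open>h \<in> T\<close> unfolding T_def \<phi>_def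
        by (cases "j = j0") (auto simp: PiE_def extensional_def)
    qed
  qed
  have "finite T" unfolding T_def by (intro finite_PiE) auto
  moreover have "(\<Sum>j\<in>UNIV. \<phi> g j) = n" if "g \<in> T" for g
  proof -
    have "(\<Sum>i\<in>UNIV - {j0}. g i) \<le> (\<Sum>i\<in>UNIV - {j0}. n div d)"
      using that by (intro sum_mono) (auto simp: T_def)
    also have "\<dots> = (d - 1) * (n div d)" by (simp add: d_def)
    also have "\<dots> \<le> d * (n div d)" by simp
    also have "\<dots> \<le> n" by simp
    finally have "(\<Sum>i\<in>UNIV - {j0}. g i) \<le> n" .
    moreover have "(\<Sum>j\<in>UNIV. \<phi> g j) = \<phi> g j0 + (\<Sum>j\<in>UNIV - {j0}. \<phi> g j)"
      by (simp add: sum.remove)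
    moreover have "(\<Sum>j\<in>UNIV - {j0}. \<phi> g j) = (\<Sum>j\<in>UNIV - {j0}. g j)"
      by (intro sum.cong) (auto simp: \<phi>_def)
    ultimately show ?thesis by (simp add: \<phi>_def)
  qed
  moreover have "(real n / real d) ^ (d - 1) \<le> real (card (\<phi> ` T))"
  proof -
    have "real n / real d \<le> real (n div d + 1)"
    proof -
      have "n \<le> (n div d + 1) * d"
        using dividend_less_times_div[OF d, of n] by (simp add: algebra_simps)
      hence "real n \<le> real (n div d + 1) * real d" by (simp only: of_nat_mult[symmetric] of_nat_le_iff)
      thus ?thesis using d by (simp add: pos_divide_le_eq)
    qed
    hence "(real n / real d) ^ (d - 1) \<le> real (n div d + 1) ^ (d - 1)"
      by (intro power_mono) auto
    also have "\<dots> = real (card T)" by (simp add: T_def card_PiE d_def)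
    finally show ?thesis by (simp add: card_image[OF inj])
  qed
  ultimately show ?thesis by (intro exI[of _ "\<phi> ` T"]) (auto simp: d_def)
qed

section \<open>Hat functions and their Fourier coefficients\<close>

text \<open>Measurability is needed jointly in the point and in \<open>u\<close>, because the outer
  norm integrates over \<open>u\<close>. The convolution step is measurability of a parameter
  integral.\<close>

lemma borel_measurable_hat [measurable]:
  assumes [measurable]: "f \<in> borel_measurable M" "g \<in> borel_measurable M"
  shows "(\<lambda>p. hat r (f p) (g p)) \<in> borel_measurable M"
proof -
  have "(\<lambda>p. hat r (fst p) (snd p)) \<in> borel_measurable (borel \<Otimes>\<^sub>M borel)"
  proof (induction r)
    case (Suc r)
    have hat1: "hat (Suc 0) x u = (if - u / 2 \<le> x \<and> x < u / 2 then 1 else 0)" for x u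
      by (simp add: indicator_def)
    show ?case
    proof (cases r)
      case 0
      show ?thesis unfolding 0 hat1 by measurable
    next
      case r: (Suc n)
      have *: "(\<lambda>q. hat r (f q) (g q)) \<in> borel_measurable M'"
        if [measurable]: "f \<in> borel_measurable M'" "g \<in> borel_measurable M'"
        for f g :: "_ \<Rightarrow> real" and M' :: "((real \<times> real) \<times> real) measure"
        using measurable_compose[OF _ Suc.IH, of "\<lambda>q. (f q, g q)" M'] by simp
      have [measurable]: "(\<lambda>q. hat r (fst (fst q) - snd q) (snd (fst q)))
          \<in> borel_measurable ((borel \<Otimes>\<^sub>M borel) \<Otimes>\<^sub>M lborel)"
        by (rule *) measurable
      have "(\<lambda>p. \<integral>y. hat r (fst p - y) (snd p) * hat (Suc 0) y (snd p) \<partial>lborel)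
          \<in> borel_measurable (borel \<Otimes>\<^sub>M borel)"
        unfolding hat1
        by (intro lborel.borel_measurable_lebesgue_integral) (unfold case_prod_beta, measurable)
      thus ?thesis by (simp add: r real_convolution_def)
    qed
  qed simp
  from measurable_compose[OF _ this, of "\<lambda>p. (f p, g p)" M] show ?thesis by simp
qed

lemma integrable_indicator_Ico [simp]: "integrable lborel (indicator {a..<b} :: real \<Rightarrow> real)"
  by (cases "a \<le> b") auto

text \<open>Each convolution integrates a function with values in [0, 1] over an interval of length
  \<open>u <= 1\<close>.\<close>

lemma hat_bounds:
  assumes u: "0 < u" "u \<le> 1"
  shows "0 \<le> hat r x u" "hat r x u \<le> 1"
proof -
  have "0 \<le> hat r x u \<and> hat r x u \<le> 1"
  proof (induction r arbitrary: x)
    case (Suc r)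
    show ?case
    proof (cases r)
      case r: (Suc n)
      have "0 \<le> hat (Suc r) x u"
        using Suc.IH unfolding r hat.simps real_convolution_def
        by (intro Bochner_Integration.integral_nonneg) auto
      moreover have "hat (Suc r) x u \<le> (\<integral>y. indicator {- u / 2..<u / 2} y \<partial>lborel)"
        using Suc.IH unfolding r hat.simps real_convolution_def
        by (intro integral_mono' integrable_indicator_Ico) (auto simp: mult_left_le_one_le)
      moreover have "(\<integral>y. indicator {- u / 2..<u / 2} y \<partial>lborel) = u"
        using u by simp
      ultimately show ?thesis using u by linarith
    qed (simp add: indicator_def)
  qed simp
  thus "0 \<le> hat r x u" "hat r x u \<le> 1" by auto
qed

lemma hat_eq_0:
  assumes "\<bar>x\<bar> > real r * u / 2"
  shows "hat r x u = 0"
  using assms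
proof (induction r arbitrary: x)
  case (Suc r)
  show ?case
  proof (cases r)
    case 0
    thus ?thesis using Suc.prems by (auto simp: indicator_def)
  next
    case r: (Suc n)
    have "hat r (x - y) u * indicator {- u / 2..<u / 2} y = 0" for y
    proof (cases "y \<in> {- u / 2..<u / 2}")
      case True
      hence "\<bar>y\<bar> \<le> u / 2" by auto
      moreover have "\<bar>x\<bar> \<le> \<bar>x - y\<bar> + \<bar>y\<bar>" by simp
      moreover have "real (Suc r) * u / 2 = real r * u / 2 + u / 2" by (simp add: algebra_simps add_divide_distrib)
      ultimately have "\<bar>x - y\<bar> > real r * u / 2" using Suc.prems by linarith
      thus ?thesis using Suc.IH by simp
    qed simp
    thus ?thesis unfolding r hat.simps real_convolution_def by (simp only: Bochner_Integration.integral_zero)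
  qed
qed simp

lemma integrable_hat:
  assumes u: "0 < u" "u \<le> 1"
  shows "integrable lborel (\<lambda>x. complex_of_real (hat r x u) * cis (c * x))"
proof -
  let ?A = "{- (real r * u / 2)..real r * u / 2}"
  have "integrable lborel (\<lambda>x. indicator ?A x *\<^sub>R (complex_of_real (hat r x u) * cis (c * x)))"
    using hat_bounds[OF u] u
    by (intro integrableI_bounded_set_indicator[where B = 1]) (auto simp: norm_mult)
  also have "(\<lambda>x. indicator ?A x *\<^sub>R (complex_of_real (hat r x u) * cis (c * x)))
      = (\<lambda>x. complex_of_real (hat r x u) * cis (c * x))"
    using hat_eq_0[of r u] by (force simp: indicator_def fun_eq_iff abs_le_iff)
  finally show ?thesis .
qed

text \<open>Fourier transform of the indicator of \<open>[-u/2, u/2)\<close> at the integer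
  \<open>k\<close>, a sinc function; the value at 0 is its limit.\<close>

definition hat_coeff :: "int \<Rightarrow> real \<Rightarrow> real" where
  "hat_coeff k u = (if k = 0 then u else sin (pi * of_int k * u) / (pi * of_int k))"

lemma hat_fourier_1:
  assumes u: "0 < u"
  shows "(\<integral>x. complex_of_real (hat (Suc 0) x u) * cis (2 * pi * of_int k * x) \<partial>lborel)
    = of_real (hat_coeff k u)"
proof -
  have eq: "(\<integral>x. complex_of_real (hat (Suc 0) x u) * cis (2 * pi * of_int k * x) \<partial>lborel)
      = (LINT x:{- u / 2..<u / 2}|lborel. cis (2 * pi * of_int k * x))"
    unfolding set_lebesgue_integral_def
    by (intro Bochner_Integration.integral_cong) (auto simp: indicator_def)
  show ?thesis
  proof (cases "k = 0")
    case True
    thus ?thesis using u unfolding eq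
      by (simp add: hat_coeff_def set_lebesgue_integral_def scaleR_conv_of_real)
  next
    case False
    have "(LINT x:{- u / 2..<u / 2}|lborel. cis (2 * pi * of_int k * x))
        = (cis (pi * of_int k * u) - cis (- (pi * of_int k * u))) / (\<i> * of_real (2 * pi * of_int k))"
      using integral_cis(2)[of "- u / 2" "u / 2" "2 * pi * of_int k"] False u by (simp add: field_simps)
    also have "cis (pi * of_int k * u) - cis (- (pi * of_int k * u)) = 2 * \<i> * of_real (sin (pi * of_int k * u))"
      by (simp add: complex_eq_iff)
    finally show ?thesis unfolding eq using False by (simp add: hat_coeff_def field_simps)
  qed
qed

text \<open>The convolution theorem: each further factor of the convolution multiplies the transform
  by \<open>hat_coeff k u\<close>.\<close>

lemma hat_fourier:
  assumes u: "0 < u" "u \<le> 1" and r: "r \<ge> 1"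
  shows "(\<integral>x. complex_of_real (hat r x u) * cis (2 * pi * of_int k * x) \<partial>lborel)
    = of_real (hat_coeff k u) ^ r"
  using r
proof (induction r rule: dec_induct)
  case base
  show ?case using hat_fourier_1[OF u(1), of k] by simp
next
  case (step r)
  let ?c = "2 * pi * of_int k"
  let ?F = "\<lambda>x y. complex_of_real (hat r (x - y) u * hat (Suc 0) y u) * cis (?c * x)"
  from step obtain n where r: "r = Suc n" by (cases r) auto
  have hat_Suc: "hat (Suc r) x u = (\<integral>y. hat r (x - y) u * hat (Suc 0) y u \<partial>lborel)" for x
    by (simp add: r real_convolution_def)
  have int_y: "integrable lborel (\<lambda>y. hat r (x - y) u * hat (Suc 0) y u)" for x
    by (rule Bochner_Integration.integrable_bound[OF integrable_indicator_Ico[of "- u / 2" "u / 2"]])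
       (use hat_bounds[OF u] in \<open>auto simp: abs_mult indicator_def intro!: AE_I2\<close>)
  have int: "integrable (lborel \<Otimes>\<^sub>M lborel) (\<lambda>(x, y). ?F x y)"
  proof (rule lborel_pair.Fubini_integrable)
    show "(\<lambda>(x, y). ?F x y) \<in> borel_measurable (lborel \<Otimes>\<^sub>M lborel)"
      by measurable
    \<comment> \<open>As both hat factors are nonnegative, integrating the modulus over
      \<open>y\<close> gives the next hat function, which is already known to be integrable.\<close>
    have "(\<integral>y. norm (?F x y) \<partial>lborel) = hat (Suc r) x u" for x
      unfolding hat_Suc using hat_bounds[OF u]
      by (intro Bochner_Integration.integral_cong) (auto simp: norm_mult abs_mult simp del: hat.simps)
    moreover have "integrable lborel (\<lambda>x. hat (Suc r) x u)"
      using integrable_norm[OF integrable_hat[OF u, of "Suc r" 0]] hat_bounds[OF u]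
      by (simp add: norm_mult del: hat.simps)
    ultimately show "integrable lborel (\<lambda>x. \<integral>y. norm (case (x, y) of (x, y) \<Rightarrow> ?F x y) \<partial>lborel)"
      by simp
    show "AE x in lborel. integrable lborel (\<lambda>y. case (x, y) of (x, y) \<Rightarrow> ?F x y)"
      using int_y by (intro AE_I2) (simp only: prod.case, intro integrable_mult_left integrable_of_real)
  qed
  have "(\<integral>x. complex_of_real (hat (Suc r) x u) * cis (?c * x) \<partial>lborel)
      = (\<integral>x. \<integral>y. ?F x y \<partial>lborel \<partial>lborel)"
    unfolding hat_Suc by (simp del: hat.simps of_real_mult)
  also have "\<dots> = (\<integral>y. \<integral>x. ?F x y \<partial>lborel \<partial>lborel)"
    using lborel_pair.Fubini_integral[OF int] by simp
  also have "\<dots> = (\<integral>y. of_real (hat_coeff k u) ^ r * (complex_of_real (hat (Suc 0) y u) * cis (?c * y)) \<partial>lborel)"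
  proof (rule Bochner_Integration.integral_cong[OF refl])
    fix y :: real
    have "(\<integral>x. ?F x y \<partial>lborel) = (\<integral>x. ?F (y + 1 * x) y \<partial>lborel)"
      by (subst lborel_integral_real_affine[of 1 _ y]) simp_all
    also have "\<dots> = (\<integral>x. complex_of_real (hat (Suc 0) y u) * cis (?c * y)
        * (complex_of_real (hat r x u) * cis (?c * x)) \<partial>lborel)"
      by (intro Bochner_Integration.integral_cong) (auto simp: cis_mult algebra_simps simp del: hat.simps)
    also have "\<dots> = complex_of_real (hat (Suc 0) y u) * cis (?c * y) * of_real (hat_coeff k u) ^ r"
      by (simp only: integral_mult_right_zero step.IH)
    finally show "(\<integral>x. ?F x y \<partial>lborel)
        = of_real (hat_coeff k u) ^ r * (complex_of_real (hat (Suc 0) y u) * cis (?c * y))"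
      by (simp only: mult.commute)
  qed
  also have "\<dots> = of_real (hat_coeff k u) ^ r * of_real (hat_coeff k u)"
    by (simp only: integral_mult_right_zero hat_fourier_1[OF u(1)])
  finally show ?case by (simp add: mult.commute del: hat.simps)
qed

section \<open>Periodization\<close>

text \<open>The integer translates of [0, 1) tile the interval that carries \<open>g\<close>; at
  each point only the translate with \<open>n\<close> equal to the floor contributes.\<close>

lemma integral_unfold_periodization:
  fixes g :: "real \<Rightarrow> complex" and R :: int
  assumes g: "integrable lborel g" and supp: "\<And>t. t \<notin> {- of_int R..<of_int R + 1} \<Longrightarrow> g t = 0"
  shows "(LINT t:{0..<1}|lborel. (\<Sum>n\<in>{-R..R}. g (of_int n + t))) = (\<integral>t. g t \<partial>lborel)"
proof -
  have int: "set_integrable lborel {0..<1} (\<lambda>t. g (of_int n + t))" for n :: int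
    using lborel_integrable_real_affine[OF g, of 1 "of_int n"]
    unfolding set_integrable_def by (intro integrable_mult_indicator) auto
  have shift: "(LINT t:{0..<1}|lborel. g (of_int n + t))
      = (\<integral>t. indicator {of_int n..<of_int n + 1} t *\<^sub>R g t \<partial>lborel)" for n :: int
    unfolding set_lebesgue_integral_def
    by (subst (2) lborel_integral_real_affine[of 1 _ "of_int n"])
       (auto intro!: Bochner_Integration.integral_cong simp: indicator_def)
  have pointwise: "(\<Sum>n\<in>{-R..R}. indicator {of_int n..<of_int n + 1} t *\<^sub>R g t) = g t" for t
  proof -
    have "(\<Sum>n\<in>{-R..R}. indicator {of_int n..<of_int n + 1} t *\<^sub>R g t)
        = (\<Sum>n\<in>{-R..R}. if n = \<lfloor>t\<rfloor> then g t else 0)"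
      by (intro sum.cong refl) (auto simp: indicator_def floor_eq_iff, linarith+)
    also have "\<dots> = g t"
    proof (cases "t \<in> {- of_int R..<of_int R + 1}")
      case True
      hence "\<lfloor>t\<rfloor> \<in> {-R..R}" by (auto simp: le_floor_iff floor_le_iff)
      thus ?thesis by simp
    next
      case False
      thus ?thesis using supp by simp
    qed
    finally show ?thesis .
  qed
  have "(LINT t:{0..<1}|lborel. (\<Sum>n\<in>{-R..R}. g (of_int n + t)))
      = (\<Sum>n\<in>{-R..R}. LINT t:{0..<1}|lborel. g (of_int n + t))"
    unfolding set_lebesgue_integral_def scaleR_sum_right
    using int by (intro Bochner_Integration.integral_sum) (auto simp: set_integrable_def)
  also have "\<dots> = (\<integral>t. (\<Sum>n\<in>{-R..R}. indicator {of_int n..<of_int n + 1} t *\<^sub>R g t) \<partial>lborel)"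
    unfolding shift using g
    by (intro Bochner_Integration.integral_sum[symmetric] integrable_mult_indicator) auto
  finally show ?thesis by (simp only: pointwise)
qed

text \<open>For \<open>\<bar>t\<bar> < 1\<close> and \<open>0 < u \<le> 1\<close> the omitted terms vanish, so this is the full periodization.\<close>

definition hat_sum :: "nat \<Rightarrow> real \<Rightarrow> real \<Rightarrow> real" where
  "hat_sum r t u = (\<Sum>n\<in>{- (int r + 1)..int r + 1}. hat r (of_int n + t) u)"

lemma borel_measurable_hat_sum [measurable]:
  assumes [measurable]: "f \<in> borel_measurable M" "g \<in> borel_measurable M"
  shows "(\<lambda>p. hat_sum r (f p) (g p)) \<in> borel_measurable M"
  unfolding hat_sum_def by measurable

lemma hat_sum_bounds:
  assumes u: "0 < u" "u \<le> 1"
  shows "0 \<le> hat_sum r t u" "hat_sum r t u \<le> 2 * real r + 3"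
proof -
  show "0 \<le> hat_sum r t u"
    unfolding hat_sum_def using hat_bounds[OF u] by (intro sum_nonneg)
  have "hat_sum r t u \<le> (\<Sum>n\<in>{- (int r + 1)..int r + 1}. 1)"
    unfolding hat_sum_def using hat_bounds[OF u] by (intro sum_mono)
  thus "hat_sum r t u \<le> 2 * real r + 3" by simp
qed

lemma hat_eq_0_far:
  assumes u: "0 < u" "u \<le> 1" and t: "\<bar>t\<bar> > real r"
  shows "hat r t u = 0"
proof (rule hat_eq_0)
  have "real r * u / 2 \<le> real r * 1" using u by (intro order_trans[OF _ mult_left_mono[of u 1]]) auto
  thus "real r * u / 2 < \<bar>t\<bar>" using t by simp
qed

text \<open>The exponential is 1-periodic, so the sum of translates unfolds to an integral over the
  line. The reflection of \<open>t\<close> to \<open>x - t\<close> then reverses the sign of the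
  exponent, as \<open>hat_fourier\<close> requires, and splits off the phase at
  \<open>x\<close>.\<close>

lemma hat_sum_fourier:
  assumes u: "0 < u" "u \<le> 1" and r: "r \<ge> 1" and x: "0 \<le> x" "x < 1"
  shows "(LINT z:{0..<1}|lborel. complex_of_real (hat_sum r (x - z) u) * cnj (cis (2 * pi * of_int k * z)))
      = cnj (cis (2 * pi * of_int k * x)) * of_real (hat_coeff k u) ^ r"
proof -
  let ?c = "2 * pi * of_int k"
  define g where "g t = complex_of_real (hat r (x - t) u) * cis (- ?c * t)" for t
  have g_eq: "g (x + (-1) * t) = cis (- ?c * x) * (complex_of_real (hat r t u) * cis (?c * t))" for t
    by (simp add: g_def cis_mult algebra_simps)
  have "integrable lborel (\<lambda>t. g (x + (-1) * t))"
    unfolding g_eq by (intro integrable_mult_right integrable_hat u)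
  hence int_g: "integrable lborel g"
    by (subst (asm) lborel_integrable_real_affine_iff) auto
  have period: "cnj (cis (?c * z)) = cis (- ?c * (of_int n + z))" for n :: int and z
  proof -
    have "cis (- ?c * (of_int n + z)) = cis (2 * pi * of_int (- k * n)) * cis (- ?c * z)"
      by (simp add: cis_mult algebra_simps)
    also have "cis (2 * pi * of_int (- k * n)) = 1" by (rule cis_multiple_2pi) simp
    finally show ?thesis by (simp add: cis_cnj)
  qed
  have "complex_of_real (hat_sum r (x - z) u) * cnj (cis (?c * z))
      = (\<Sum>n\<in>{- (int r + 1)..int r + 1}. g (of_int n + z))" for z
  proof -
    have "hat_sum r (x - z) u = (\<Sum>n\<in>{- (int r + 1)..int r + 1}. hat r (x - (of_int n + z)) u)"
      unfolding hat_sum_def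
      by (rule sum.reindex_bij_witness[of _ uminus uminus]) (auto simp: algebra_simps)
    thus ?thesis using period[of z] by (simp add: sum_distrib_right g_def)
  qed
  hence "(LINT z:{0..<1}|lborel. complex_of_real (hat_sum r (x - z) u) * cnj (cis (?c * z)))
      = (LINT z:{0..<1}|lborel. \<Sum>n\<in>{- (int r + 1)..int r + 1}. g (of_int n + z))"
    by simp
  also have "\<dots> = (\<integral>t. g t \<partial>lborel)"
  proof (rule integral_unfold_periodization[OF int_g])
    fix t assume "t \<notin> {- of_int (int r + 1)..<of_int (int r + 1) + 1 :: real}"
    hence "\<bar>x - t\<bar> > real r" using x by auto
    thus "g t = 0" by (simp add: g_def hat_eq_0_far[OF u])
  qed
  also have "\<dots> = (\<integral>t. g (x + (-1) * t) \<partial>lborel)"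
    by (subst lborel_integral_real_affine[of "-1" _ x]) simp_all
  also have "\<dots> = cis (- ?c * x) * of_real (hat_coeff k u) ^ r"
    unfolding g_eq by (simp only: integral_mult_right_zero hat_fourier[OF u r])
  finally show ?thesis by (simp add: cis_cnj)
qed

lemma integral_hat_sum:
  assumes u: "0 < u" "u \<le> 1" and r: "r \<ge> 1" and z: "0 \<le> z" "z < 1"
  shows "(LINT x:{0..<1}|lborel. complex_of_real (hat_sum r (x - z) u)) = of_real u ^ r"
proof -
  define g where "g t = complex_of_real (hat r (t - z) u)" for t
  have g_eq: "g (z + 1 * t) = complex_of_real (hat r t u)" for t
    by (simp add: g_def)
  have "integrable lborel (\<lambda>t. g (z + 1 * t))"
    unfolding g_eq using integrable_hat[OF u, of r 0] by simp
  hence int_g: "integrable lborel g"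
    by (subst (asm) lborel_integrable_real_affine_iff) auto
  have "(LINT x:{0..<1}|lborel. complex_of_real (hat_sum r (x - z) u))
      = (LINT x:{0..<1}|lborel. \<Sum>n\<in>{- (int r + 1)..int r + 1}. g (of_int n + x))"
    by (simp add: hat_sum_def g_def add_diff_eq)
  also have "\<dots> = (\<integral>t. g t \<partial>lborel)"
  proof (rule integral_unfold_periodization[OF int_g])
    fix t assume "t \<notin> {- of_int (int r + 1)..<of_int (int r + 1) + 1 :: real}"
    hence "\<bar>t - z\<bar> > real r" using z by auto
    thus "g t = 0" by (simp add: g_def hat_eq_0_far[OF u])
  qed
  also have "\<dots> = (\<integral>t. g (z + 1 * t) \<partial>lborel)"
    by (subst lborel_integral_real_affine[of 1 _ z]) simp_all
  also have "\<dots> = of_real u ^ r"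
    unfolding g_eq using hat_fourier[OF u r, of 0] by (simp add: hat_coeff_def)
  finally show ?thesis .
qed

text \<open>The support of the hat function cuts the lattice sum down to a box, over which the sum
  of products is a product of sums.\<close>

lemma periodic_hat_eq_prod:
  fixes x z :: "real ^ 'd::finite"
  assumes u: "0 < u" "u \<le> 1" and x: "x \<in> half_open_cube" and z: "z \<in> half_open_cube"
  shows "periodic_hat r x z u = (\<Prod>j\<in>UNIV. hat_sum r (x $ j - z $ j) u)"
proof -
  define B where "B = PiE UNIV (\<lambda>_::'d. {- (int r + 1)..int r + 1})"
  let ?F = "\<lambda>n :: int ^ 'd. \<Prod>j\<in>UNIV. hat r (of_int (n $ j) + x $ j - z $ j) u"
  have fin: "finite B" unfolding B_def by (intro finite_PiE) auto
  have inj: "inj_on (vec_lambda :: ('d \<Rightarrow> int) \<Rightarrow> int^'d) A" for A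
    by (auto simp: inj_on_def vec_lambda_inject)
  have zero: "?F n = 0" if "n \<notin> vec_lambda ` B" for n
  proof -
    have "vec_nth n \<notin> B"
    proof
      assume "vec_nth n \<in> B"
      hence "vec_lambda (vec_nth n) \<in> vec_lambda ` B" by (rule imageI)
      with that show False by simp
    qed
    then obtain j where "n $ j \<notin> {- (int r + 1)..int r + 1}"
      unfolding B_def PiE_UNIV_domain Pi_iff by blast
    \<comment> \<open>Outside the window the shift is at least \<open>r + 2\<close>, and
      \<open>x $ j - z $ j\<close> takes back less than 1, so the argument leaves the
      support.\<close>
    hence "real_of_int (n $ j) \<le> - real r - 2 \<or> real_of_int (n $ j) \<ge> real r + 2" by auto
    moreover have "\<bar>x $ j - z $ j\<bar> < 1"
      using x z unfolding half_open_cube_def mem_Collect_eq by (smt (verit))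
    ultimately have "\<bar>of_int (n $ j) + x $ j - z $ j\<bar> > real r" by linarith
    thus ?thesis using hat_eq_0_far[OF u] by (intro prod_zero) auto
  qed
  have "periodic_hat r x z u = (\<Sum>\<^sub>\<infinity>n\<in>vec_lambda ` B. ?F n)"
    unfolding periodic_hat_def using zero by (intro infsum_cong_neutral) auto
  also have "\<dots> = (\<Sum>n\<in>vec_lambda ` B. ?F n)"
    using fin by (intro infsum_finite) auto
  also have "\<dots> = (\<Sum>g\<in>B. \<Prod>j\<in>UNIV. hat r (of_int (g j) + (x $ j - z $ j)) u)"
    by (subst sum.reindex[OF inj]) (simp add: add_diff_eq)
  also have "\<dots> = (\<Prod>j\<in>UNIV. hat_sum r (x $ j - z $ j) u)"
    unfolding B_def hat_sum_def by (rule prod_sum_PiE[symmetric]) auto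
  finally show ?thesis .
qed

lemma set_integrable_hat_sum:
  fixes f :: "real \<Rightarrow> real" and h :: "real \<Rightarrow> complex"
  assumes u: "0 < u" "u \<le> 1" and [measurable]: "f \<in> borel_measurable borel" "h \<in> borel_measurable borel"
    and h: "\<And>t. norm (h t) \<le> 1"
  shows "set_integrable lborel {0..<1} (\<lambda>t. complex_of_real (hat_sum r (f t) u) * h t)"
  unfolding set_integrable_def
proof (rule integrableI_bounded_set_indicator[where B = "2 * real r + 3"])
  show "AE t in lborel. t \<in> {0..<1} \<longrightarrow> norm (complex_of_real (hat_sum r (f t) u) * h t) \<le> 2 * real r + 3"
    using hat_sum_bounds[OF u, of r] mult_mono[OF _ h] by (intro AE_I2) (force simp: norm_mult)
qed auto

lemma periodic_hat_fourier:
  fixes x :: "real ^ 'd::finite"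
  assumes u: "0 < u" "u \<le> 1" and r: "r \<ge> 1" and x: "x \<in> half_open_cube"
  shows "integrable cube_measure (\<lambda>z. complex_of_real (periodic_hat r x z u) * cnj (character k z))"
    and "(\<integral>z. complex_of_real (periodic_hat r x z u) * cnj (character k z) \<partial>cube_measure)
      = cnj (character k x) * of_real (\<Prod>j\<in>UNIV. hat_coeff (k $ j) u ^ r)"
proof -
  let ?h = "\<lambda>j t. complex_of_real (hat_sum r (x $ j - t) u) * cnj (cis (2 * pi * of_int (k $ j) * t))"
  have eq: "complex_of_real (periodic_hat r x z u) * cnj (character k z) = (\<Prod>j\<in>UNIV. ?h j (z $ j))"
    if "z \<in> space cube_measure" for z
    using that by (simp add: periodic_hat_eq_prod[OF u x] space_restrict_space character_def prod.distrib)
  have int: "set_integrable lborel {0..<1} (?h j)" for j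
    by (rule set_integrable_hat_sum[OF u]) auto
  show "integrable cube_measure (\<lambda>z. complex_of_real (periodic_hat r x z u) * cnj (character k z))"
    using integrable_cube_prod[OF int]
    by (subst Bochner_Integration.integrable_cong[OF refl eq])
  have "(\<integral>z. complex_of_real (periodic_hat r x z u) * cnj (character k z) \<partial>cube_measure)
      = (\<integral>z. (\<Prod>j\<in>UNIV. ?h j (z $ j)) \<partial>cube_measure)"
    by (rule Bochner_Integration.integral_cong[OF refl eq])
  also have "\<dots> = (\<Prod>j\<in>UNIV. LINT t:{0..<1}|lborel. ?h j t)"
    by (rule integral_cube_prod[OF int])
  also have "\<dots> = (\<Prod>j\<in>UNIV. cnj (cis (2 * pi * of_int (k $ j) * x $ j)) * of_real (hat_coeff (k $ j) u) ^ r)"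
    using x by (intro prod.cong refl hat_sum_fourier u r) (auto simp: half_open_cube_def)
  finally show "(\<integral>z. complex_of_real (periodic_hat r x z u) * cnj (character k z) \<partial>cube_measure)
      = cnj (character k x) * of_real (\<Prod>j\<in>UNIV. hat_coeff (k $ j) u ^ r)"
    by (simp add: character_def prod.distrib)
qed

lemma integral_periodic_hat:
  fixes z :: "real ^ 'd::finite"
  assumes u: "0 < u" "u \<le> 1" and r: "r \<ge> 1" and z: "z \<in> half_open_cube"
  shows "(LINT x:half_open_cube|lborel. periodic_hat r x z u) = u ^ (r * CARD('d))"
proof -
  have eq: "complex_of_real (periodic_hat r x z u) = (\<Prod>j\<in>UNIV. complex_of_real (hat_sum r (x $ j - z $ j) u))"
    if "x \<in> space cube_measure" for x
    using that by (simp add: periodic_hat_eq_prod[OF u _ z] space_restrict_space)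
  have int: "set_integrable lborel {0..<1} (\<lambda>t. complex_of_real (hat_sum r (t - z $ j) u))" for j
    using set_integrable_hat_sum[OF u, of "\<lambda>t. t - z $ j" "\<lambda>_. 1"] by simp
  have "complex_of_real (LINT x:half_open_cube|lborel. periodic_hat r x z u)
      = (\<integral>x. complex_of_real (periodic_hat r x z u) \<partial>cube_measure)"
    by (simp add: set_lebesgue_integral_def integral_restrict_space)
  also have "\<dots> = (\<integral>x. (\<Prod>j\<in>UNIV. complex_of_real (hat_sum r (x $ j - z $ j) u)) \<partial>cube_measure)"
    by (rule Bochner_Integration.integral_cong[OF refl eq])
  also have "\<dots> = (\<Prod>j\<in>UNIV. LINT t:{0..<1}|lborel. complex_of_real (hat_sum r (t - z $ j) u))"
    by (rule integral_cube_prod[OF int])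
  also have "\<dots> = (\<Prod>j\<in>(UNIV::'d set). of_real u ^ r)"
    using z by (intro prod.cong refl integral_hat_sum u r) (auto simp: half_open_cube_def)
  also have "\<dots> = complex_of_real (u ^ (r * CARD('d)))"
    by (simp add: power_mult)
  finally show ?thesis by (simp only: of_real_eq_iff)
qed

section \<open>Averaging over the side length\<close>

text \<open>\<open>|sin (pi * x)|\<close> depends only on the distance of \<open>x\<close> to the
  nearest integer and increases with it up to 1/2.\<close>

lemma abs_sin_pi_ge:
  assumes \<eta>: "0 < \<eta>" "\<eta> \<le> 1 / 2" and far: "\<eta> \<le> \<bar>x - of_int (round x)\<bar>"
  shows "sin (pi * \<eta>) \<le> \<bar>sin (pi * x)\<bar>"
proof -
  define t where "t = x - of_int (round x)"
  have t: "\<eta> \<le> \<bar>t\<bar>" "\<bar>t\<bar> \<le> 1 / 2"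
    using far of_int_round_abs_le[of x] by (auto simp: t_def abs_minus_commute)
  have "(cos (pi * of_int (round x)))\<^sup>2 = (1::real)"
    using sin_cos_squared_add[of "pi * of_int (round x)"] by simp
  hence cos: "\<bar>cos (pi * of_int (round x)) :: real\<bar> = 1"
    by (auto simp: power2_eq_1_iff)
  have "sin (pi * x) = sin (pi * t + pi * of_int (round x))"
    by (simp add: t_def algebra_simps)
  also have "\<dots> = sin (pi * t) * cos (pi * of_int (round x))"
    by (simp add: sin_add)
  finally have "\<bar>sin (pi * x)\<bar> = \<bar>sin (pi * t)\<bar>" by (simp add: abs_mult cos)
  also have "\<dots> = sin (pi * \<bar>t\<bar>)"
  proof -
    have "0 \<le> sin (pi * \<bar>t\<bar>)" using t by (intro sin_ge_zero) auto
    thus ?thesis by (cases "t \<ge> 0") auto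
  qed
  also have "sin (pi * \<eta>) \<le> sin (pi * \<bar>t\<bar>)"
    using \<eta> t by (subst sin_mono_le_eq) (auto simp: field_simps intro: order_trans[of _ 0])
  finally show ?thesis .
qed

text \<open>There are \<open>|k| + 1 <= 2 * |k|\<close> intervals of length
  \<open>2 * \<eta> / |k|\<close>. What matters is that the bound is uniform in
  \<open>k\<close>.\<close>

lemma measure_near_multiples:
  assumes k: "k \<noteq> 0" and \<eta>: "0 < \<eta>"
  shows "measure lborel (\<Union>a\<in>{0..\<bar>k\<bar>}. {(of_int a - \<eta>) / \<bar>of_int k\<bar><..<(of_int a + \<eta>) / \<bar>of_int k\<bar>}) \<le> 4 * \<eta>"
proof -
  have k1: "1 \<le> \<bar>real_of_int k\<bar>" using k by linarith
  have "measure lborel (\<Union>a\<in>{0..\<bar>k\<bar>}. {(of_int a - \<eta>) / \<bar>of_int k\<bar><..<(of_int a + \<eta>) / \<bar>of_int k\<bar>})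
      \<le> (\<Sum>a\<in>{0..\<bar>k\<bar>}. measure lborel {(of_int a - \<eta>) / \<bar>of_int k\<bar><..<(of_int a + \<eta>) / \<bar>real_of_int k\<bar>})"
    by (intro measure_UNION_le) auto
  also have "\<dots> = (\<Sum>a\<in>{0..\<bar>k\<bar>}. 2 * \<eta> / \<bar>real_of_int k\<bar>)"
    using k1 \<eta> by (intro sum.cong refl) (simp add: divide_right_mono flip: diff_divide_distrib)
  also have "\<dots> = (\<bar>real_of_int k\<bar> + 1) * (2 * \<eta> / \<bar>real_of_int k\<bar>)"
    by simp
  also have "\<dots> \<le> (2 * \<bar>real_of_int k\<bar>) * (2 * \<eta> / \<bar>real_of_int k\<bar>)"
    using k1 \<eta> by (intro mult_right_mono) auto
  also have "\<dots> = 4 * \<eta>" using k1 by simp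
  finally show ?thesis .
qed

text \<open>For \<open>k = 0\<close> the coefficient is \<open>u\<close> itself, whence the
  restriction to \<open>u > 1/4\<close> and the 1/4 in the minimum. Otherwise the integer nearest to
  \<open>|k| * u\<close> lies in \<open>{0..|k|}\<close>, so the finite union covers every zero of
  the sine that could come close.\<close>

lemma abs_hat_coeff_ge:
  assumes u: "1 / 4 < u" "u \<le> 1 / 2" and \<eta>: "0 < \<eta>" "\<eta> \<le> 1 / 2"
    and far: "k \<noteq> 0 \<Longrightarrow>
      u \<notin> (\<Union>a\<in>{0..\<bar>k\<bar>}. {(of_int a - \<eta>) / \<bar>of_int k\<bar><..<(of_int a + \<eta>) / \<bar>of_int k\<bar>})"
  shows "min (1 / 4) (sin (pi * \<eta>) / pi) / max 1 \<bar>of_int k\<bar> \<le> \<bar>hat_coeff k u\<bar>"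
proof (cases "k = 0")
  case True
  thus ?thesis using u by (simp add: hat_coeff_def)
next
  case False
  define K where "K = \<bar>real_of_int k\<bar>"
  have K: "K \<ge> 1" using False by (simp add: K_def)
  define a where "a = round (K * u)"
  have "0 \<le> a" using K u by (simp add: a_def round_def)
  moreover have "a \<le> \<bar>k\<bar>"
  proof -
    have "K * u \<le> K * (1 / 2)" using K u by (intro mult_left_mono) auto
    hence "real_of_int a \<le> K / 2 + 1 / 2" using of_int_round_le[of "K * u"] by (simp add: a_def)
    also have "\<dots> \<le> K" using K by simp
    finally show ?thesis by (simp add: K_def flip: of_int_abs)
  qed
  ultimately have "u \<notin> {(of_int a - \<eta>) / K<..<(of_int a + \<eta>) / K}"
    using far[OF False] by (auto simp: K_def)
  hence "\<eta> \<le> \<bar>K * u - of_int a\<bar>"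
    using K by (auto simp: divide_less_eq less_divide_eq mult.commute)
  hence "sin (pi * \<eta>) \<le> \<bar>sin (pi * (K * u))\<bar>"
    unfolding a_def by (intro abs_sin_pi_ge \<eta>)
  also have "\<dots> = \<bar>sin (pi * of_int k * u)\<bar>"
    by (simp add: K_def abs_if mult.assoc)
  finally have "sin (pi * \<eta>) / pi / K \<le> \<bar>sin (pi * of_int k * u)\<bar> / pi / K"
    using K by (intro divide_right_mono) auto
  moreover have "min (1 / 4) (sin (pi * \<eta>) / pi) / K \<le> sin (pi * \<eta>) / pi / K"
    using K by (intro divide_right_mono) auto
  moreover have "\<bar>hat_coeff k u\<bar> = \<bar>sin (pi * of_int k * u)\<bar> / pi / K"
    using False by (simp add: hat_coeff_def K_def abs_mult)
  moreover have "max 1 \<bar>of_int k\<bar> = K" using K by (simp add: K_def)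
  ultimately show ?thesis by simp
qed

abbreviation side_measure :: "real measure" where
  "side_measure \<equiv> restrict_space lborel {0<..1/2}"

lemma finite_measure_side: "finite_measure side_measure"
  by (intro finite_measureI) (auto simp: emeasure_restrict_space space_restrict_space)

lemma abs_hat_coeff_le:
  assumes "0 < u" "u \<le> 1"
  shows "\<bar>hat_coeff k u\<bar> \<le> 1"
proof (cases "k = 0")
  case False
  hence "1 \<le> \<bar>real_of_int k\<bar>" by linarith
  hence "1 * 1 \<le> pi * \<bar>real_of_int k\<bar>" using pi_gt3 by (intro mult_mono) auto
  hence "\<bar>sin (pi * of_int k * u)\<bar> \<le> pi * \<bar>real_of_int k\<bar>" using abs_sin_le_one[of "pi * of_int k * u"] by linarith
  thus ?thesis using False by (simp add: hat_coeff_def abs_mult divide_le_eq)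
qed (use assms in \<open>simp add: hat_coeff_def\<close>)

lemma borel_measurable_hat_coeff [measurable]: "hat_coeff k \<in> borel_measurable borel"
  unfolding hat_coeff_def[abs_def] by measurable

lemma integrable_hat_coeff_prod:
  "integrable side_measure (\<lambda>u. \<Prod>j\<in>(UNIV::'d::finite set). hat_coeff (k $ j) u ^ (2 * r))"
proof -
  interpret finite_measure side_measure by (rule finite_measure_side)
  have "\<bar>\<Prod>j\<in>(UNIV::'d set). hat_coeff (k $ j) u ^ (2 * r)\<bar> \<le> 1" if "u \<in> space side_measure" for u
    unfolding abs_prod using that abs_hat_coeff_le[of u]
    by (intro prod_le_1) (auto simp: space_restrict_space power_abs intro!: power_le_one)
  thus ?thesis
    by (intro integrable_const_bound[where B = 1] AE_I2 measurable_restrict_space1) auto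
qed

text \<open>
  Outside a set of measure at most 1/8, \<open>u\<close> keeps distance \<open>\<eta> / \<bar>k\<^sub>j\<bar>\<close> from the zeros of
  \<open>sin (\<pi> k\<^sub>j u)\<close> simultaneously for all \<open>j\<close>.
\<close>

lemma integral_hat_coeff_ge:
  "\<exists>c>0. \<forall>k :: int ^ 'd::finite. c / freq_weight r k
    \<le> (\<integral>u. (\<Prod>j\<in>UNIV. hat_coeff (k $ j) u ^ (2 * r)) \<partial>side_measure)"
proof -
  \<comment> \<open>The exceptional sets of all coordinates have total measure at most
    \<open>CARD('d) * 4 * \<eta> = 1/8\<close>, half the length of \<open>{1/4<..1/2}\<close>. The
    other half yields the divisor 8 in \<open>c'\<close>.\<close>
  define \<eta> where "\<eta> = 1 / (32 * real CARD('d))"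
  have card_ge: "1 \<le> real CARD('d)" by (simp add: Suc_leI)
  have \<eta>: "0 < \<eta>" "\<eta> \<le> 1 / 2"
    unfolding \<eta>_def using card_ge by (simp, intro frac_le) linarith+
  define c where "c = min (1 / 4) (sin (pi * \<eta>) / pi)"
  have "c > 0" using \<eta> by (auto simp: c_def intro!: divide_pos_pos sin_gt_zero)
  define c' where "c' = c ^ (2 * r * CARD('d)) / 8"
  have "c' / freq_weight r k \<le> (\<integral>u. (\<Prod>j\<in>UNIV. hat_coeff (k $ j) u ^ (2 * r)) \<partial>side_measure)"
    for k :: "int ^ 'd"
  proof -
    define bad where "bad i = (\<Union>a\<in>{0..\<bar>i\<bar>}. {(of_int a - \<eta>) / \<bar>of_int i\<bar><..<(of_int a + \<eta>) / \<bar>real_of_int i\<bar>})" for i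
    define Bad where "Bad = (\<Union>j\<in>{j. k $ j \<noteq> 0}. bad (k $ j))"
    define G where "G = {1/4<..1/2} - Bad"
    have bad_meas [measurable]: "bad i \<in> sets borel" for i
      unfolding bad_def by (intro sets.finite_UN) auto
    have bad_fin: "bad i \<in> fmeasurable lborel" for i
      unfolding bad_def by (intro fmeasurable.finite_UN fmeasurableI emeasure_bounded_finite) auto
    have Bad_meas [measurable]: "Bad \<in> sets borel"
      unfolding Bad_def by (intro sets.finite_UN) auto
    have G_meas [measurable]: "G \<in> sets borel" unfolding G_def by measurable
    have "measure lborel Bad \<le> (\<Sum>j\<in>{j. k $ j \<noteq> 0}. measure lborel (bad (k $ j)))"
      unfolding Bad_def by (intro measure_UNION_le) auto
    also have "\<dots> \<le> (\<Sum>j\<in>{j. k $ j \<noteq> 0}. 4 * \<eta>)"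
      using measure_near_multiples[OF _ \<eta>(1)] by (intro sum_mono) (auto simp: bad_def)
    also have "\<dots> \<le> real CARD('d) * (4 * \<eta>)"
      using \<eta> by (simp add: card_mono)
    finally have Bad_le: "measure lborel Bad \<le> 1 / 8" by (simp add: \<eta>_def)
    have Bad_fin: "Bad \<in> fmeasurable lborel"
      unfolding Bad_def using bad_fin by (intro fmeasurable.finite_UN) auto
    have "bounded G" by (rule bounded_subset[of "{1/4..1/2}"]) (auto simp: G_def)
    hence G_fin: "G \<in> fmeasurable lborel" by (intro fmeasurableI emeasure_bounded_finite) auto
    have "measure lborel {1/4<..1/2::real} \<le> measure lborel (G \<union> Bad)"
      using Bad_fin G_fin by (intro measure_mono_fmeasurable fmeasurable.Un) (auto simp: G_def)
    also have "\<dots> \<le> measure lborel G + measure lborel Bad"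
      by (rule measure_Un_le) auto
    finally have G_ge: "1 / 8 \<le> measure lborel G" using Bad_le by simp
    have pointwise: "indicator G u * (c ^ (2 * r * CARD('d)) / freq_weight r k)
        \<le> (\<Prod>j\<in>UNIV. hat_coeff (k $ j) u ^ (2 * r))" for u
    proof (cases "u \<in> G")
      case False
      thus ?thesis by (auto intro!: prod_nonneg)
    next
      case True
      have "c / max 1 \<bar>of_int (k $ j)\<bar> \<le> \<bar>hat_coeff (k $ j) u\<bar>" for j
        unfolding c_def by (rule abs_hat_coeff_ge) (use True \<eta> in \<open>auto simp: G_def Bad_def bad_def\<close>)
      hence "(\<Prod>j\<in>UNIV. (c / max 1 \<bar>of_int (k $ j)\<bar>) ^ (2 * r)) \<le> (\<Prod>j\<in>UNIV. \<bar>hat_coeff (k $ j) u\<bar> ^ (2 * r))"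
        using \<open>c > 0\<close> by (intro prod_mono conjI power_mono) auto
      also have "\<dots> = (\<Prod>j\<in>UNIV. hat_coeff (k $ j) u ^ (2 * r))" by (simp add: power_even_abs)
      also have "(\<Prod>j\<in>UNIV. (c / max 1 \<bar>of_int (k $ j)\<bar>) ^ (2 * r)) = c ^ (2 * r * CARD('d)) / freq_weight r k"
        by (simp add: freq_weight_def power_divide prod_dividef power_mult)
      finally show ?thesis using True by simp
    qed
    have G_sub: "G \<subseteq> {0<..1/2}" by (auto simp: G_def)
    have "c' / freq_weight r k \<le> measure lborel G * (c ^ (2 * r * CARD('d)) / freq_weight r k)"
      using mult_right_mono[OF G_ge, of "c ^ (2 * r * CARD('d)) / freq_weight r k"] freq_weight_pos[of r k] \<open>c > 0\<close>
      by (simp add: c'_def)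
    also have "\<dots> = (\<integral>u. indicator G u * (c ^ (2 * r * CARD('d)) / freq_weight r k) \<partial>side_measure)"
      using G_sub by (simp add: measure_restrict_space space_restrict_space Int_absorb2)
    also have "\<dots> \<le> (\<integral>u. (\<Prod>j\<in>UNIV. hat_coeff (k $ j) u ^ (2 * r)) \<partial>side_measure)"
      using pointwise by (intro integral_mono' integrable_hat_coeff_prod) (auto intro!: prod_nonneg)
    finally show ?thesis .
  qed
  moreover have "c' > 0" using \<open>c > 0\<close> by (simp add: c'_def)
  ultimately show ?thesis by blast
qed

section \<open>The lower bound\<close>

text \<open>The error on the conjugate exponential; as the weights are real, this is the conjugate
  of the error on \<open>character k\<close>.\<close>

definition exp_error :: "nat \<Rightarrow> (nat \<Rightarrow> real ^ 'd::finite) \<Rightarrow> (nat \<Rightarrow> real) \<Rightarrow> int ^ 'd \<Rightarrow> complex" where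
  "exp_error m \<xi> \<Lambda> k =
    (if k = 0 then 1 else 0) - (\<Sum>\<mu>=1..m. of_real (\<Lambda> \<mu>) * cnj (character k (\<xi> \<mu>)))"

context
  fixes r m :: nat and \<xi> :: "nat \<Rightarrow> real ^ 'd::finite" and \<Lambda> :: "nat \<Rightarrow> real"
  assumes r: "r \<ge> 1" and \<xi>: "\<And>\<mu>. \<mu> \<in> {1..m} \<Longrightarrow> \<xi> \<mu> \<in> half_open_cube"
begin

lemma cubature_error_eq:
  assumes "0 < u" "u \<le> 1" "z \<in> half_open_cube"
  shows "cubature_error r m \<xi> \<Lambda> z u =
    u ^ (r * CARD('d)) - (\<Sum>\<mu>=1..m. \<Lambda> \<mu> * (\<Prod>j\<in>UNIV. hat_sum r (\<xi> \<mu> $ j - z $ j) u))"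
  using assms r \<xi> by (simp add: cubature_error_def integral_periodic_hat periodic_hat_eq_prod)

lemma cubature_error_bounded:
  "\<exists>B. \<forall>u z. 0 < u \<longrightarrow> u \<le> 1 \<longrightarrow> z \<in> half_open_cube \<longrightarrow> \<bar>cubature_error r m \<xi> \<Lambda> z u\<bar> \<le> B"
proof -
  have "\<bar>cubature_error r m \<xi> \<Lambda> z u\<bar> \<le> 1 + (\<Sum>\<mu>=1..m. \<bar>\<Lambda> \<mu>\<bar> * (2 * real r + 3) ^ CARD('d))"
    if u: "0 < u" "u \<le> 1" and z: "z \<in> half_open_cube" for u z
  proof -
    have "\<bar>\<Prod>j\<in>(UNIV::'d set). hat_sum r (\<xi> \<mu> $ j - z $ j) u\<bar> \<le> (2 * real r + 3) ^ CARD('d)" for \<mu>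
    proof -
      have "(\<Prod>j\<in>(UNIV::'d set). \<bar>hat_sum r (\<xi> \<mu> $ j - z $ j) u\<bar>) \<le> (\<Prod>j\<in>(UNIV::'d set). 2 * real r + 3)"
        using hat_sum_bounds[OF u, of r] by (intro prod_mono) auto
      thus ?thesis by (simp add: abs_prod)
    qed
    hence "\<bar>\<Sum>\<mu>=1..m. \<Lambda> \<mu> * (\<Prod>j\<in>UNIV. hat_sum r (\<xi> \<mu> $ j - z $ j) u)\<bar>
        \<le> (\<Sum>\<mu>=1..m. \<bar>\<Lambda> \<mu>\<bar> * (2 * real r + 3) ^ CARD('d))"
      by (intro order_trans[OF sum_abs] sum_mono) (auto simp: abs_mult intro!: mult_left_mono)
    moreover have "\<bar>u ^ (r * CARD('d))\<bar> \<le> 1"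
      using u by (simp add: power_le_one)
    ultimately show ?thesis
      unfolding cubature_error_eq[OF u z] by linarith
  qed
  thus ?thesis by blast
qed

text \<open>Stated for the explicit formula, since \<open>cubature_error\<close> is identified with
  it only for \<open>0 < u <= 1\<close> and \<open>z\<close> in the cube; the result is transferred
  where it is used.\<close>

lemma cubature_error_measurable:
  "(\<lambda>(u, z). u ^ (r * CARD('d)) - (\<Sum>\<mu>=1..m. \<Lambda> \<mu> * (\<Prod>j\<in>UNIV. hat_sum r (\<xi> \<mu> $ j - z $ j) u)))
    \<in> borel_measurable (borel \<Otimes>\<^sub>M (cube_measure :: (real ^ 'd) measure))"
proof -
  have [measurable]: "(\<lambda>z. z $ j) \<in> borel_measurable (cube_measure :: (real ^ 'd) measure)" for j
    by (intro measurable_restrict_space1) simp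
  show ?thesis by measurable
qed

lemma cubature_error_fourier:
  assumes u: "0 < u" "u \<le> 1"
  shows "integrable cube_measure (\<lambda>z. complex_of_real (cubature_error r m \<xi> \<Lambda> z u) * cnj (character k z))"
    and "(\<integral>z. complex_of_real (cubature_error r m \<xi> \<Lambda> z u) * cnj (character k z) \<partial>cube_measure)
      = of_real (\<Prod>j\<in>UNIV. hat_coeff (k $ j) u ^ r) * exp_error m \<xi> \<Lambda> k"
proof -
  define H where "H = (\<Prod>j\<in>UNIV. hat_coeff (k $ j) u ^ r)"
  have eq: "complex_of_real (cubature_error r m \<xi> \<Lambda> z u) * cnj (character k z)
      = of_real (u ^ (r * CARD('d))) * cnj (character k z)
        - (\<Sum>\<mu>=1..m. of_real (\<Lambda> \<mu>) * (complex_of_real (periodic_hat r (\<xi> \<mu>) z u) * cnj (character k z)))"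
    if "z \<in> space cube_measure" for z
    using that integral_periodic_hat[OF u r, of z]
    by (simp add: cubature_error_def space_restrict_space algebra_simps sum_distrib_left)
  have has: "has_bochner_integral cube_measure
      (\<lambda>z. complex_of_real (cubature_error r m \<xi> \<Lambda> z u) * cnj (character k z))
      (of_real (u ^ (r * CARD('d))) * (if k = 0 then 1 else 0)
        - (\<Sum>\<mu>=1..m. of_real (\<Lambda> \<mu>) * (cnj (character k (\<xi> \<mu>)) * of_real H)))"
  proof (subst has_bochner_integral_cong[OF refl eq refl], assumption, intro has_bochner_integral_diff has_bochner_integral_sum has_bochner_integral_mult_right)
    show "has_bochner_integral cube_measure (\<lambda>z. cnj (character k z)) (if k = 0 then 1 else 0)"
      using integrable_character[of k] by (simp add: has_bochner_integral_iff integral_character)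
    show "has_bochner_integral cube_measure (\<lambda>z. complex_of_real (periodic_hat r (\<xi> \<mu>) z u) * cnj (character k z))
        (cnj (character k (\<xi> \<mu>)) * of_real H)" if "\<mu> \<in> {1..m}" for \<mu>
      using periodic_hat_fourier[OF u r \<xi>[OF that]] by (simp add: has_bochner_integral_iff H_def)
  qed
  \<comment> \<open>At \<open>k = 0\<close> the integral term carries the same factor
    \<open>H\<close> as the knots, and at other frequencies it vanishes, so \<open>H\<close> factors
    out in all cases.\<close>
  have H_0: "H = u ^ (r * CARD('d))" if "k = 0"
    using that by (simp add: H_def hat_coeff_def power_mult)
  have "of_real (u ^ (r * CARD('d))) * (if k = 0 then 1 else 0)
        - (\<Sum>\<mu>=1..m. of_real (\<Lambda> \<mu>) * (cnj (character k (\<xi> \<mu>)) * of_real H))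
      = of_real H * exp_error m \<xi> \<Lambda> k"
    using H_0 by (auto simp: exp_error_def algebra_simps sum_distrib_left)
  with has show "integrable cube_measure (\<lambda>z. complex_of_real (cubature_error r m \<xi> \<Lambda> z u) * cnj (character k z))"
    and "(\<integral>z. complex_of_real (cubature_error r m \<xi> \<Lambda> z u) * cnj (character k z) \<partial>cube_measure)
      = of_real (\<Prod>j\<in>UNIV. hat_coeff (k $ j) u ^ r) * exp_error m \<xi> \<Lambda> k"
    by (simp_all add: has_bochner_integral_iff H_def)
qed

lemma integrable_cubature_error_sq:
  assumes u: "0 < u" "u \<le> 1"
  shows "integrable cube_measure (\<lambda>z. (cubature_error r m \<xi> \<Lambda> z u)\<^sup>2)"
proof -
  interpret finite_measure "cube_measure :: (real^'d) measure" by (rule finite_measure_cube)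
  obtain B where B: "\<And>z. z \<in> half_open_cube \<Longrightarrow> \<bar>cubature_error r m \<xi> \<Lambda> z u\<bar> \<le> B"
    using cubature_error_bounded u by blast
  let ?E = "\<lambda>z. u ^ (r * CARD('d)) - (\<Sum>\<mu>=1..m. \<Lambda> \<mu> * (\<Prod>j\<in>UNIV. hat_sum r (\<xi> \<mu> $ j - z $ j) u))"
  have [measurable]: "(\<lambda>z. z $ j) \<in> borel_measurable (cube_measure :: (real ^ 'd) measure)" for j
    by (intro measurable_restrict_space1) simp
  have "(\<lambda>z. cubature_error r m \<xi> \<Lambda> z u) \<in> borel_measurable cube_measure
      \<longleftrightarrow> ?E \<in> borel_measurable cube_measure"
    using cubature_error_eq[OF u] by (intro measurable_cong) (simp add: space_restrict_space)
  moreover have "?E \<in> borel_measurable cube_measure" by measurable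
  ultimately have [measurable]: "(\<lambda>z. cubature_error r m \<xi> \<Lambda> z u) \<in> borel_measurable cube_measure" by blast
  show ?thesis
  proof (rule integrable_const_bound[where B = "B\<^sup>2"])
    show "AE z in cube_measure. norm ((cubature_error r m \<xi> \<Lambda> z u)\<^sup>2) \<le> B\<^sup>2"
      using power_mono[OF B, of _ 2] by (intro AE_I2) (simp add: space_restrict_space)
  qed measurable
qed

lemma bessel_cubature_error:
  assumes u: "0 < u" "u \<le> 1" and K: "finite K"
  shows "(\<Sum>k\<in>K. (\<Prod>j\<in>UNIV. hat_coeff (k $ j) u ^ (2 * r)) * (cmod (exp_error m \<xi> \<Lambda> k))\<^sup>2)
    \<le> (\<integral>z. (cubature_error r m \<xi> \<Lambda> z u)\<^sup>2 \<partial>cube_measure)"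
proof -
  have "(\<Prod>j\<in>UNIV. hat_coeff (k $ j) u ^ (2 * r)) * (cmod (exp_error m \<xi> \<Lambda> k))\<^sup>2
      = (cmod (\<integral>z. complex_of_real (cubature_error r m \<xi> \<Lambda> z u) * cnj (character k z) \<partial>cube_measure))\<^sup>2" for k
    unfolding cubature_error_fourier(2)[OF u]
    by (simp only: norm_mult norm_of_real power_mult_distrib power2_abs prod_power_distrib
        power_mult[symmetric] mult.commute[of r 2])
  hence "(\<Sum>k\<in>K. (\<Prod>j\<in>UNIV. hat_coeff (k $ j) u ^ (2 * r)) * (cmod (exp_error m \<xi> \<Lambda> k))\<^sup>2)
      = (\<Sum>k\<in>K. (cmod (\<integral>z. complex_of_real (cubature_error r m \<xi> \<Lambda> z u) * cnj (character k z) \<partial>cube_measure))\<^sup>2)"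
    by simp
  also have "\<dots> \<le> (\<integral>z. (cmod (complex_of_real (cubature_error r m \<xi> \<Lambda> z u)))\<^sup>2 \<partial>cube_measure)"
    by (rule bessel_inequality[OF K])
       (use integrable_cubature_error_sq[OF u] cubature_error_fourier(1)[OF u]
         in \<open>simp_all add: character_orthonormal\<close>)
  finally show ?thesis by simp
qed

lemma cube_discrepancy_ge:
  assumes c: "\<And>k :: int ^ 'd. c / freq_weight r k
      \<le> (\<integral>u. (\<Prod>j\<in>UNIV. hat_coeff (k $ j) u ^ (2 * r)) \<partial>side_measure)"
    and K: "finite K"
  shows "(\<Sum>k\<in>K. c / freq_weight r k * (cmod (exp_error m \<xi> \<Lambda> k))\<^sup>2) \<le> (cube_discrepancy r 2 2 m \<xi> \<Lambda>)\<^sup>2"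
    and "0 \<le> cube_discrepancy r 2 2 m \<xi> \<Lambda>"
proof -
  let ?I = "\<lambda>u. \<integral>z. (cubature_error r m \<xi> \<Lambda> z u)\<^sup>2 \<partial>cube_measure"
  have disc: "cube_discrepancy r 2 2 m \<xi> \<Lambda> = sqrt (\<integral>u. ?I u \<partial>side_measure)"
    unfolding cube_discrepancy_def Lp_norm_2 by simp
  \<comment> \<open>Without integrability the Bochner integral would be 0 by convention, and no
    lower bound could be read off from it.\<close>
  have int_I: "integrable side_measure ?I"
  proof -
    interpret side: finite_measure side_measure by (rule finite_measure_side)
    interpret cube: finite_measure "cube_measure :: (real^'d) measure" by (rule finite_measure_cube)
    let ?E = "\<lambda>u z. u ^ (r * CARD('d)) - (\<Sum>\<mu>=1..m. \<Lambda> \<mu> * (\<Prod>j\<in>UNIV. hat_sum r (\<xi> \<mu> $ j - z $ j) u))"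
    have eq: "?I u = (\<integral>z. (?E u z)\<^sup>2 \<partial>cube_measure)" if "u \<in> space side_measure" for u
      using that cubature_error_eq
      by (intro Bochner_Integration.integral_cong refl) (simp add: space_restrict_space)
    have "(\<lambda>u. \<integral>z. (?E u z)\<^sup>2 \<partial>cube_measure) \<in> borel_measurable borel"
      using cubature_error_measurable
      by (intro cube.borel_measurable_lebesgue_integral) (simp add: case_prod_beta)
    hence "(\<lambda>u. \<integral>z. (?E u z)\<^sup>2 \<partial>cube_measure) \<in> borel_measurable side_measure"
      by (intro measurable_restrict_space1) simp
    hence meas: "?I \<in> borel_measurable side_measure"
      by (subst measurable_cong[OF eq])
    obtain B where B: "\<And>u z. 0 < u \<Longrightarrow> u \<le> 1 \<Longrightarrow> z \<in> half_open_cube \<Longrightarrow> \<bar>cubature_error r m \<xi> \<Lambda> z u\<bar> \<le> B"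
      using cubature_error_bounded by blast
    have "norm (?I u) \<le> B\<^sup>2" if "u \<in> space side_measure" for u
    proof -
      have "?I u \<le> (\<integral>z. B\<^sup>2 \<partial>(cube_measure :: (real^'d) measure))"
        using that power_mono[OF B, of u _ 2]
        by (intro integral_mono') (auto simp: space_restrict_space)
      thus ?thesis using measure_cube[where 'd = 'd] by simp
    qed
    thus ?thesis using meas by (intro side.integrable_const_bound[where B = "B\<^sup>2"] AE_I2)
  qed
  have "(\<Sum>k\<in>K. c / freq_weight r k * (cmod (exp_error m \<xi> \<Lambda> k))\<^sup>2)
      \<le> (\<Sum>k\<in>K. (\<integral>u. (\<Prod>j\<in>UNIV. hat_coeff (k $ j) u ^ (2 * r)) \<partial>side_measure) * (cmod (exp_error m \<xi> \<Lambda> k))\<^sup>2)"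
    using c by (intro sum_mono mult_right_mono) auto
  also have "\<dots> = (\<integral>u. (\<Sum>k\<in>K. (\<Prod>j\<in>UNIV. hat_coeff (k $ j) u ^ (2 * r)) * (cmod (exp_error m \<xi> \<Lambda> k))\<^sup>2) \<partial>side_measure)"
    using integrable_hat_coeff_prod by (subst Bochner_Integration.integral_sum) auto
  also have "\<dots> \<le> (\<integral>u. ?I u \<partial>side_measure)"
    using bessel_cubature_error[OF _ _ K] integrable_hat_coeff_prod int_I
    by (intro integral_mono Bochner_Integration.integrable_sum integrable_mult_left)
       (auto simp: space_restrict_space)
  finally show "(\<Sum>k\<in>K. c / freq_weight r k * (cmod (exp_error m \<xi> \<Lambda> k))\<^sup>2) \<le> (cube_discrepancy r 2 2 m \<xi> \<Lambda>)\<^sup>2"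
    unfolding disc by simp
  show "0 \<le> cube_discrepancy r 2 2 m \<xi> \<Lambda>"
    unfolding disc by simp
qed

end

text \<open>Pairing the coefficients \<open>C\<close> with the errors removes the cubature sum,
  because the polynomial vanishes at the knots; only the mean \<open>C 0\<close> is left.
  Cauchy-Schwarz with the weight split between the two factors finishes.\<close>

lemma cubature_duality:
  assumes fin: "finite P" and zero: "0 \<in> P"
    and vanish: "\<And>\<mu>. \<mu> \<in> {1..m} \<Longrightarrow> (\<Sum>\<kappa>\<in>P. C \<kappa> * character \<kappa> (\<xi> \<mu>)) = 0"
  shows "(cmod (C 0))\<^sup>2
    \<le> (\<Sum>\<kappa>\<in>P. freq_weight r \<kappa> * (cmod (C \<kappa>))\<^sup>2)
      * (\<Sum>\<kappa>\<in>P. (cmod (exp_error m \<xi> \<Lambda> \<kappa>))\<^sup>2 / freq_weight r \<kappa>)"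
proof -
  have "(\<Sum>\<kappa>\<in>P. C \<kappa> * cnj (exp_error m \<xi> \<Lambda> \<kappa>))
      = (\<Sum>\<kappa>\<in>P. if \<kappa> = 0 then C \<kappa> else 0)
        - (\<Sum>\<kappa>\<in>P. \<Sum>\<mu>=1..m. of_real (\<Lambda> \<mu>) * (C \<kappa> * character \<kappa> (\<xi> \<mu>)))"
    unfolding exp_error_def sum_subtractf[symmetric]
    by (intro sum.cong refl) (simp add: algebra_simps sum_distrib_left)
  also have "(\<Sum>\<kappa>\<in>P. \<Sum>\<mu>=1..m. of_real (\<Lambda> \<mu>) * (C \<kappa> * character \<kappa> (\<xi> \<mu>)))
      = (\<Sum>\<mu>=1..m. of_real (\<Lambda> \<mu>) * (\<Sum>\<kappa>\<in>P. C \<kappa> * character \<kappa> (\<xi> \<mu>)))"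
    by (subst sum.swap) (simp only: sum_distrib_left)
  also have "\<dots> = 0" using vanish by simp
  finally have "C 0 = (\<Sum>\<kappa>\<in>P. C \<kappa> * cnj (exp_error m \<xi> \<Lambda> \<kappa>))"
    using fin zero by simp
  hence "cmod (C 0) \<le> (\<Sum>\<kappa>\<in>P. cmod (C \<kappa>) * cmod (exp_error m \<xi> \<Lambda> \<kappa>))"
    using norm_sum[of "\<lambda>\<kappa>. C \<kappa> * cnj (exp_error m \<xi> \<Lambda> \<kappa>)" P] by (simp add: norm_mult)
  also have "\<dots> = (\<Sum>\<kappa>\<in>P. (sqrt (freq_weight r \<kappa>) * cmod (C \<kappa>))
      * (cmod (exp_error m \<xi> \<Lambda> \<kappa>) / sqrt (freq_weight r \<kappa>)))"
    by (intro sum.cong refl) simp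
  finally have "(cmod (C 0))\<^sup>2 \<le> (\<Sum>\<kappa>\<in>P. (sqrt (freq_weight r \<kappa>) * cmod (C \<kappa>))
      * (cmod (exp_error m \<xi> \<Lambda> \<kappa>) / sqrt (freq_weight r \<kappa>)))\<^sup>2"
    by (rule power_mono) simp
  also have "\<dots> \<le> (\<Sum>\<kappa>\<in>P. (sqrt (freq_weight r \<kappa>) * cmod (C \<kappa>))\<^sup>2)
      * (\<Sum>\<kappa>\<in>P. (cmod (exp_error m \<xi> \<Lambda> \<kappa>) / sqrt (freq_weight r \<kappa>))\<^sup>2)"
    by (rule Cauchy_Schwarz_ineq_sum)
  also have "\<dots> = (\<Sum>\<kappa>\<in>P. freq_weight r \<kappa> * (cmod (C \<kappa>))\<^sup>2)
      * (\<Sum>\<kappa>\<in>P. (cmod (exp_error m \<xi> \<Lambda> \<kappa>))\<^sup>2 / freq_weight r \<kappa>)"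
    by (simp add: power_mult_distrib power_divide)
  finally show ?thesis .
qed

text \<open>The base 0 occurs for \<open>m = 1\<close>, where the logarithm vanishes. There
  \<open>n >= 1\<close> matters, as \<open>0 powr 0 = 0\<close> but
  \<open>0 ^ 0 = 1\<close>.\<close>

lemma powr_half_sq:
  assumes "x \<ge> 0" "n \<ge> 1"
  shows "(x powr (real n / 2))\<^sup>2 = x ^ n"
proof (cases "x = 0")
  case False
  hence "(x powr (real n / 2))\<^sup>2 = x powr real n"
    using assms by (simp add: powr_add[symmetric] power2_eq_square)
  thus ?thesis using False assms by (simp add: powr_realpow)
qed (use assms in auto)

theorem theorem3p2:
  fixes r :: nat
  assumes "CARD('d::finite) \<ge> 2" and "r \<ge> 1"
  shows "\<exists>C::real. C > 0 \<and>
    (\<forall>m::nat. m \<ge> 1 \<longrightarrow>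
      (\<forall>(\<xi> :: nat \<Rightarrow> real ^ 'd) (\<Lambda> :: nat \<Rightarrow> real).
        (\<forall>\<mu>\<in>{1..m}. \<xi> \<mu> \<in> half_open_cube) \<longrightarrow>
          cube_discrepancy r 2 2 m \<xi> \<Lambda>
            \<ge> C * real m powr (- real r) * ln (real m) powr ((real CARD('d) - 1) / 2)))"
proof -
  define d where "d = CARD('d)"
  have d: "d \<ge> 2" using assms by (simp add: d_def)
  obtain c where c: "c > 0" and c_le: "\<And>k :: int ^ 'd. c / freq_weight r k
      \<le> (\<integral>u. (\<Prod>j\<in>UNIV. hat_coeff (k $ j) u ^ (2 * r)) \<partial>side_measure)"
    using integral_hat_coeff_ge[where 'd = 'd and r = r] by blast
  \<comment> \<open>The divisor collects 4 from squaring the mean \<open>card S / 2\<close>,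
    \<open>4 ^ d\<close> from the cross terms, \<open>4 ^ (2 * r)\<close> from
    \<open>2 ^ n <= 4 * m\<close>, and the power of \<open>d\<close> from the count of the
    boxes.\<close>
  define A where "A = c / (4 * 4 ^ d * 4 ^ (2 * r) * real d ^ (d - 1))"
  have A: "A > 0" using c d by (simp add: A_def)
  show ?thesis
  proof (intro exI[of _ "sqrt A"] conjI allI impI)
    show "sqrt A > 0" using A by simp
    fix m :: nat and \<xi> :: "nat \<Rightarrow> real ^ 'd" and \<Lambda> :: "nat \<Rightarrow> real"
    assume m: "m \<ge> 1" and \<xi>: "\<forall>\<mu>\<in>{1..m}. \<xi> \<mu> \<in> half_open_cube"
    define disc where "disc = cube_discrepancy r 2 2 m \<xi> \<Lambda>"
    obtain n where n: "2 * m \<le> 2 ^ n" "2 ^ n \<le> 4 * m"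
    proof -
      obtain n where "2 ^ n < 2 * m" "2 * m \<le> 2 ^ (n + 1)"
        using ex_power_ivl2[of 2 "2 * m"] m by auto
      thus ?thesis by (intro that[of "n + 1"]) auto
    qed
    obtain S :: "('d \<Rightarrow> nat) set" where fin_S: "finite S" and S: "\<And>s. s \<in> S \<Longrightarrow> (\<Sum>j\<in>UNIV. s j) = n"
      and card_S: "(real n / real d) ^ (d - 1) \<le> real (card S)"
      using many_compositions[where 'd = 'd and n = n] unfolding d_def by blast
    define P where "P = {\<kappa> :: int ^ 'd. \<forall>j. \<bar>\<kappa> $ j\<bar> \<le> 2 ^ n}"
    have fin_P: "finite P" unfolding P_def by (rule finite_int_box)
    have zero_P: "0 \<in> P" by (simp add: P_def)
    \<comment> \<open>The knots are numbered from 1, the test polynomials count them from 0; hence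
      the shift by \<open>Suc\<close>.\<close>
    obtain C :: "int ^ 'd \<Rightarrow> complex" where C_0: "real (card S) / 2 \<le> Re (C 0)"
      and C_norm: "(\<Sum>\<kappa>\<in>P. freq_weight r \<kappa> * (cmod (C \<kappa>))\<^sup>2) \<le> 4 ^ (r * n) * 4 ^ d * real (card S)"
      and C_zero: "\<And>\<mu>. \<mu> < m \<Longrightarrow> (\<Sum>\<kappa>\<in>P. C \<kappa> * character \<kappa> (\<xi> (Suc \<mu>))) = 0"
      using fooling_polynomial_hyperbolic[OF assms(2) fin_S S n(1), of "\<lambda>\<mu>. \<xi> (Suc \<mu>)"]
      unfolding P_def d_def by blast
    define E where "E = (\<Sum>\<kappa>\<in>P. (cmod (exp_error m \<xi> \<Lambda> \<kappa>))\<^sup>2 / freq_weight r \<kappa>)"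
    have E_nonneg: "E \<ge> 0"
      unfolding E_def by (intro sum_nonneg) simp
    have vanish: "(\<Sum>\<kappa>\<in>P. C \<kappa> * character \<kappa> (\<xi> \<mu>)) = 0" if "\<mu> \<in> {1..m}" for \<mu>
      using that C_zero[of "\<mu> - 1"] by auto
    have disc_ge: "c * E \<le> disc\<^sup>2" and disc_nonneg: "0 \<le> disc"
      using cube_discrepancy_ge[OF assms(2) _ c_le fin_P, of m \<xi> \<Lambda>] \<xi>
      by (simp_all add: disc_def E_def sum_distrib_left)
    \<comment> \<open>Positivity allows one factor \<open>card S\<close> to be cancelled below; the
      factor that survives becomes the power of the logarithm.\<close>
    have card_pos: "real (card S) > 0"
    proof -
      have "n > 0" using n m by (cases n) auto
      hence "0 < (real n / real d) ^ (d - 1)" using d by simp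
      thus ?thesis using card_S by linarith
    qed
    have "(real (card S) / 2)\<^sup>2 \<le> (cmod (C 0))\<^sup>2"
      using C_0 complex_Re_le_cmod[of "C 0"] by (intro power_mono) auto
    also have "\<dots> \<le> (\<Sum>\<kappa>\<in>P. freq_weight r \<kappa> * (cmod (C \<kappa>))\<^sup>2) * E"
      unfolding E_def by (rule cubature_duality[OF fin_P zero_P]) (rule vanish)
    also have "\<dots> \<le> (4 ^ (r * n) * 4 ^ d * real (card S)) * E"
      using C_norm E_nonneg by (rule mult_right_mono)
    finally have "real (card S) / 4 * real (card S) \<le> (4 ^ (r * n) * 4 ^ d * E) * real (card S)"
      by (simp add: power2_eq_square mult_ac)
    hence "real (card S) / 4 \<le> 4 ^ (r * n) * 4 ^ d * E"
      using card_pos by (simp only: mult_le_cancel_right_pos)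
    hence "c * (real (card S) / 4) \<le> c * (4 ^ (r * n) * 4 ^ d * E)"
      using c by (intro mult_left_mono) auto
    also have "\<dots> = 4 ^ (r * n) * 4 ^ d * (c * E)"
      by (simp only: mult_ac)
    also have "\<dots> \<le> (4 ^ (2 * r) * real m ^ (2 * r)) * 4 ^ d * disc\<^sup>2"
    proof -
      have "(4::real) ^ (r * n) = ((2::real) ^ n) ^ (2 * r)"
      proof -
        have "(4::real) ^ (r * n) = (2 ^ 2) ^ (r * n)" by simp
        also have "\<dots> = (2 ^ n) ^ (2 * r)" by (simp only: power_mult[symmetric] mult_ac)
        finally show ?thesis .
      qed
      also have "\<dots> \<le> (4 * real m) ^ (2 * r)"
        using of_nat_mono[OF n(2), where 'a = real] by (intro power_mono) auto
      finally have "(4::real) ^ (r * n) \<le> 4 ^ (2 * r) * real m ^ (2 * r)"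
        by (simp add: power_mult_distrib)
      thus ?thesis using disc_ge c E_nonneg by (intro mult_mono) auto
    qed
    finally have main: "c * (real (card S) / 4) \<le> (4 ^ (2 * r) * real m ^ (2 * r)) * 4 ^ d * disc\<^sup>2" .
    have "ln (real m) \<le> real n"
    proof -
      have "2 * real m \<le> 2 ^ n" using of_nat_mono[OF n(1), where 'a = real] by simp
      moreover have "0 \<le> real m" by simp
      ultimately have "real m \<le> 2 ^ n" by linarith
      hence "ln (real m) \<le> ln (2 ^ n)" using m by simp
      also have "\<dots> = real n * ln 2" by (simp add: ln_realpow)
      also have "\<dots> \<le> real n * 1" using ln_le_minus_one[of "2::real"] by (intro mult_left_mono) auto
      finally show ?thesis by simp
    qed
    hence "(ln (real m) / real d) ^ (d - 1) \<le> (real n / real d) ^ (d - 1)"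
      using m by (intro power_mono divide_right_mono) auto
    hence "c * ((ln (real m) / real d) ^ (d - 1) / 4) \<le> c * (real (card S) / 4)"
      using card_S c by (intro mult_left_mono) auto
    with main have "c * ((ln (real m) / real d) ^ (d - 1) / 4)
        \<le> (4 ^ (2 * r) * real m ^ (2 * r)) * 4 ^ d * disc\<^sup>2" by linarith
    hence "A * (ln (real m) ^ (d - 1) / real m ^ (2 * r)) \<le> disc\<^sup>2"
      using m d by (simp add: A_def power_divide field_simps)
    also have "A * (ln (real m) ^ (d - 1) / real m ^ (2 * r))
        = (sqrt A * real m powr (- real r) * ln (real m) powr ((real d - 1) / 2))\<^sup>2"
    proof -
      have "(real m powr (- real r))\<^sup>2 = 1 / real m ^ (2 * r)"
        using m by (simp add: powr_minus powr_realpow power_mult[symmetric] mult.commute divide_inverse power_inverse)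
      moreover have "(ln (real m) powr ((real d - 1) / 2))\<^sup>2 = ln (real m) ^ (d - 1)"
        using powr_half_sq[of "ln (real m)" "d - 1"] m d by (simp add: of_nat_diff)
      ultimately show ?thesis using A by (simp add: power_mult_distrib)
    qed
    finally have "sqrt A * real m powr (- real r) * ln (real m) powr ((real d - 1) / 2) \<le> disc"
      using disc_nonneg by (rule power2_le_imp_le)
    thus "sqrt A * real m powr (- real r) * ln (real m) powr ((real CARD('d) - 1) / 2)
        \<le> cube_discrepancy r 2 2 m \<xi> \<Lambda>"
      by (simp add: disc_def d_def)
  qed
qed

end
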